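(* For every integer $n\geq 3$, the hypercube graph $Q_n$ can be embedded in a surface of genus $1+(n-4)2^{n-3}$. Moreover, this embedding is a 2-cell embedding.
   Context: The hypercube graph $Q_n$ has vertex set $\{0,1\}^n$, with an edge between two vertices exactly when they differ in exactly one coordinate. A "surface" means a closed compact (connected) orientable 2-manifold. An embedding of a graph in a surface is a continuous injective map from the topological realization of the graph into the surface. The faces of the embedding are the connected components of the complement of the image of the graph; the embedding is a 2-cell embedding if each face is homeomorphic to an open disk. *)

theory Defs
  imports "HOL-Homology.Homology" "HOL-Complex_Analysis.Complex_Analysis"
begin

section \<open>Closed orientable surfaces\<close>

text \<open>The Euclidean plane is represented by the type \<^typ>\<open>complex\<close>.\<close>

definition surface_chart :: "'a topology \<Rightarrow> 'a set \<Rightarrow> ('a \<Rightarrow> complex) \<Rightarrow> bool" where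
  "surface_chart X U \<phi> \<longleftrightarrow>
     openin X U \<and> open (\<phi> ` U) \<and>
     homeomorphic_map (subtopology X U) (top_of_set (\<phi> ` U)) \<phi>"

definition two_manifold :: "'a topology \<Rightarrow> bool" where
  "two_manifold X \<longleftrightarrow>
     Hausdorff_space X \<and> second_countable X \<and>
     (\<forall>x \<in> topspace X. \<exists>U \<phi>. x \<in> U \<and> surface_chart X U \<phi>)"

text \<open>A homeomorphism between open subsets of the plane preserves orientation iff its local
  degree at each point is 1.  In the plane the local degree at a point is the winding number
  about its image of the image of a counterclockwise circle around that point; as the map is only
  continuous, this is the winding number of a merely continuous loop.\<close>

definition orientation_preserving_on :: "complex set \<Rightarrow> (complex \<Rightarrow> complex) \<Rightarrow> bool" where
  "orientation_preserving_on W h \<longleftrightarrow>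
     (\<forall>z \<in> W. \<forall>r > 0. cball z r \<subseteq> W \<longrightarrow> winding_number (h \<circ> circlepath z r) (h z) = 1)"

definition orientable_surface :: "'a topology \<Rightarrow> bool" where
  "orientable_surface X \<longleftrightarrow>
     (\<exists>\<A>. (\<forall>(U, \<phi>) \<in> \<A>. surface_chart X U \<phi>) \<and>
          (\<Union>(U, \<phi>) \<in> \<A>. U) = topspace X \<and>
          (\<forall>(U, \<phi>) \<in> \<A>. \<forall>(V, \<psi>) \<in> \<A>.
             orientation_preserving_on (\<phi> ` (U \<inter> V)) (\<psi> \<circ> inv_into U \<phi>)))"

definition closed_orientable_surface :: "'a topology \<Rightarrow> bool" where
  "closed_orientable_surface X \<longleftrightarrow>
     topspace X \<noteq> {} \<and> compact_space X \<and> connected_space X \<and>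
     two_manifold X \<and> orientable_surface X"


section \<open>Genus\<close>

text \<open>Integral linear independence in an abelian group, written multiplicatively as in
  \<^theory>\<open>HOL-Algebra.Group\<close>.\<close>

definition int_independent :: "('a, 'b) monoid_scheme \<Rightarrow> 'a set \<Rightarrow> bool" where
  "int_independent G B \<longleftrightarrow>
     finite B \<and> B \<subseteq> carrier G \<and>
     (\<forall>c :: 'a \<Rightarrow> int.
        finprod G (\<lambda>b. b [^]\<^bsub>G\<^esub> c b) B = \<one>\<^bsub>G\<^esub> \<longrightarrow> (\<forall>b \<in> B. c b = 0))"

definition has_rank :: "('a, 'b) monoid_scheme \<Rightarrow> nat \<Rightarrow> bool" where
  "has_rank G r \<longleftrightarrow>
     (\<exists>B. int_independent G B \<and> card B = r) \<and>
     (\<forall>B. int_independent G B \<longrightarrow> card B \<le> r)"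

text \<open>Alternating sum of the Betti numbers.  A relation rather than a function, so that it fails
  (instead of returning a junk value) when some Betti number or their support is infinite.\<close>

definition has_euler_characteristic :: "'a topology \<Rightarrow> int \<Rightarrow> bool" where
  "has_euler_characteristic X k \<longleftrightarrow>
     (\<exists>b :: nat \<Rightarrow> nat.
        (\<forall>p. has_rank (homology_group (int p) X) (b p)) \<and>
        finite {p. b p \<noteq> 0} \<and>
        k = (\<Sum>p | b p \<noteq> 0. (-1) ^ p * int (b p)))"

definition surface_of_genus :: "'a topology \<Rightarrow> int \<Rightarrow> bool" where
  "surface_of_genus X g \<longleftrightarrow>
     closed_orientable_surface X \<and> has_euler_characteristic X (2 - 2 * g)"


section \<open>Embeddings of finite simple graphs\<close>

text \<open>A graph is given by its vertex set and its set of two-element edges.  Its topological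
  realization consists of the barycentric coordinate functions supported on a vertex or an edge:
  the vertex \<open>v\<close> is the indicator function of \<open>v\<close>, and the edge \<open>{u, v}\<close> is the segment joining
  its ends.  The topology is that of pointwise convergence, which is the
  right one for finite graphs.\<close>

definition graph_realization :: "'v set \<Rightarrow> 'v set set \<Rightarrow> ('v \<Rightarrow> real) topology" where
  "graph_realization V E =
     top_of_set {t. (\<forall>v. 0 \<le> t v) \<and> (\<Sum>v\<in>V. t v) = 1 \<and>
                    ((\<exists>v\<in>V. {x. t x \<noteq> 0} \<subseteq> {v}) \<or> (\<exists>e\<in>E. {x. t x \<noteq> 0} \<subseteq> e))}"

definition graph_embedding ::
  "'v set \<Rightarrow> 'v set set \<Rightarrow> 'a topology \<Rightarrow> (('v \<Rightarrow> real) \<Rightarrow> 'a) \<Rightarrow> bool" where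
  "graph_embedding V E X f \<longleftrightarrow>
     continuous_map (graph_realization V E) X f \<and>
     inj_on f (topspace (graph_realization V E))"

definition embedding_faces ::
  "'v set \<Rightarrow> 'v set set \<Rightarrow> 'a topology \<Rightarrow> (('v \<Rightarrow> real) \<Rightarrow> 'a) \<Rightarrow> 'a set set" where
  "embedding_faces V E X f =
     connected_components_of
       (subtopology X (topspace X - f ` topspace (graph_realization V E)))"

definition two_cell_embedding ::
  "'v set \<Rightarrow> 'v set set \<Rightarrow> 'a topology \<Rightarrow> (('v \<Rightarrow> real) \<Rightarrow> 'a) \<Rightarrow> bool" where
  "two_cell_embedding V E X f \<longleftrightarrow>
     graph_embedding V E X f \<and>
     (\<forall>F \<in> embedding_faces V E X f.
        subtopology X F homeomorphic_space top_of_set (ball (0 :: complex) 1))"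


section \<open>Hypercube graphs\<close>

definition hypercube_vertices :: "nat \<Rightarrow> bool list set" where
  "hypercube_vertices n = {u. length u = n}"

definition hypercube_edges :: "nat \<Rightarrow> bool list set set" where
  "hypercube_edges n =
     {{u, v} | u v. u \<in> hypercube_vertices n \<and> v \<in> hypercube_vertices n \<and>
                    card {i. i < n \<and> u ! i \<noteq> v ! i} = 1}"


section \<open>The point type of surfaces\<close>

text \<open>HOL cannot quantify existentially over types, so an existence statement about surfaces has
  to fix the type of their points.  Every surface has the cardinality of the continuum, as does
  \<^typ>\<open>nat \<Rightarrow> real\<close>; hence each one is homeomorphic to some topology on (a subset of) this type.
  The topology itself is arbitrary: it need not be related to the topology of
  \<^typ>\<open>nat \<Rightarrow> real\<close>.\<close>

type_synonym surface_point = "nat \<Rightarrow> real"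

end

(*
  For a simplicial complex K on {0, ..., n-1}, the real moment-angle complex Z(n, K) is the set of
  points of the cube [-1,1]^n whose coordinates other than 1 and -1 are indexed by a face of K.  The
  surface is Z(n, K) for the n-cycle K, a union of squares of the cube.  It contains the 1-skeleton of
  the cube, whose complement in it is a disjoint union of open squares.  The link of each vertex is an
  n-cycle, so the star of a vertex is developed piecewise linearly onto a fan of n sectors in the
  plane, mirrored at the vertices with an odd number of negative coordinates; the transition maps
  between neighbouring stars are then orientation preserving.  Cutting along the last coordinate,
  Z(n+1, K) is covered by two open sets homotopy equivalent to Z(n, K) whose intersection is homotopy
  equivalent to Z(n, L), where L is the link of the last vertex.  With excision and additivity of the
  Euler characteristic in the long exact sequence of a pair, this gives the Euler characteristic as
  the sum of (-1)^|s| 2^(n - |s|) over the faces s of K.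
*)
theory Submission
  imports Defs
begin

section \<open>Rank of abelian groups\<close>

text \<open>A Betti number is not known to be finite before it is computed. Ranks therefore take
  values in \<open>enat\<close>, where rank-nullity holds without finiteness hypotheses; in a long
  exact sequence, finiteness then passes from two of the spaces to the third term. The induction on
  the number of coordinates leaves the class of cycles: dropping a vertex of a cycle leaves a path,
  and its link consists of two points. It therefore runs over all down-closed families, the empty
  one included. The transition maps are only piecewise linear, and a circle may cross several linear
  pieces. To avoid following it from piece to piece, each transition map is compared with one fixed
  rotation: the image of a displacement never points opposite to the rotated displacement. A
  straight-line homotopy then reduces the winding number to that of a rotated circle.\<close>

definition int_independent_family ::
  "('a, 'b) monoid_scheme \<Rightarrow> ('i \<Rightarrow> 'a) \<Rightarrow> 'i set \<Rightarrow> bool" where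
  "int_independent_family G g I \<longleftrightarrow>
     finite I \<and> g \<in> I \<rightarrow> carrier G \<and>
     (\<forall>c :: 'i \<Rightarrow> int. finprod G (\<lambda>i. g i [^]\<^bsub>G\<^esub> c i) I = \<one>\<^bsub>G\<^esub> \<longrightarrow> (\<forall>i \<in> I. c i = 0))"

lemma int_independentD:
  assumes "int_independent G B" "finprod G (\<lambda>b. b [^]\<^bsub>G\<^esub> c b) B = \<one>\<^bsub>G\<^esub>" "b \<in> B"
  shows "c b = (0::int)"
  using assms unfolding int_independent_def by blast

text \<open>\<open>S\<close> is a plain subset of the ambient group, so that kernels and images need
  no group structure of their own. The supremum is infinite when the sizes of independent subsets
  are unbounded.\<close>

definition rank_of :: "('a, 'b) monoid_scheme \<Rightarrow> 'a set \<Rightarrow> enat" where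
  "rank_of G S = (SUP B \<in> {B. B \<subseteq> S \<and> int_independent G B}. enat (card B))"

context comm_group
begin

text \<open>A repeated value would give a relation with coefficients 1 and -1. Families are used
  because a homomorphism may identify elements of an independent set, which a statement about the
  image set alone would not reveal.\<close>

lemma int_independent_family_inj_on:
  assumes "int_independent_family G g I"
  shows "inj_on g I"
proof (rule inj_onI, rule ccontr)
  fix i j assume ij: "i \<in> I" "j \<in> I" "g i = g j" "i \<noteq> j"
  have g: "g \<in> I \<rightarrow> carrier G" and fin: "finite I"
    using assms by (auto simp: int_independent_family_def)
  define c :: "'c \<Rightarrow> int" where "c = (\<lambda>k. if k = i then 1 else if k = j then -1 else 0)"
  have "finprod G (\<lambda>k. g k [^] c k) I = finprod G (\<lambda>k. g k [^] c k) {i, j}"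
    by (rule finprod_mono_neutral_cong_right) (use fin ij g in \<open>auto simp: c_def\<close>)
  also have "\<dots> = \<one>"
    using ij g by (subst finprod_insert) (auto simp: c_def int_pow_neg Pi_iff)
  finally have "c i = 0"
    using assms ij by (auto simp: int_independent_family_def)
  then show False by (simp add: c_def)
qed

lemma int_independent_image:
  assumes "int_independent_family G g I"
  shows "int_independent G (g ` I)" "card (g ` I) = card I"
proof -
  have inj: "inj_on g I" by (rule int_independent_family_inj_on[OF assms])
  then show "card (g ` I) = card I" by (rule card_image)
  have g: "g \<in> I \<rightarrow> carrier G" and fin: "finite I"
    using assms by (auto simp: int_independent_family_def)
  have "\<forall>b\<in>g ` I. c b = 0" if "finprod G (\<lambda>b. b [^] c b) (g ` I) = \<one>" for c :: "'a \<Rightarrow> int"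
  proof -
    have "finprod G (\<lambda>i. g i [^] c (g i)) I = \<one>"
      using that by (subst (asm) finprod_reindex) (use g inj in \<open>auto simp: Pi_iff\<close>)
    then show ?thesis
      using assms by (auto simp: int_independent_family_def)
  qed
  then show "int_independent G (g ` I)"
    using g fin by (auto simp: int_independent_def)
qed

lemma finprod_int_pow:
  assumes "finite A" "f \<in> A \<rightarrow> carrier G"
  shows "finprod G f A [^] (k::int) = finprod G (\<lambda>x. f x [^] k) A"
  using assms by (induction A rule: finite_induct) (auto simp: int_pow_distrib Pi_iff)

text \<open>In additive notation this exchanges two finite sums. It turns a relation between
  combinations of elements of \<open>B\<close> into a relation on \<open>B\<close> itself.\<close>

lemma finprod_finprod_pow:
  fixes e :: "'i \<Rightarrow> 'a \<Rightarrow> int" and d :: "'i \<Rightarrow> int"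
  assumes "finite I" "finite B" "B \<subseteq> carrier G"
  shows "finprod G (\<lambda>i. finprod G (\<lambda>x. x [^] e i x) B [^] d i) I
       = finprod G (\<lambda>x. x [^] (\<Sum>i\<in>I. e i x * d i)) B"
  using assms(1)
proof (induction I rule: finite_induct)
  case empty
  then show ?case by simp
next
  case (insert i I)
  have "finprod G (\<lambda>i. finprod G (\<lambda>x. x [^] e i x) B [^] d i) (insert i I)
      = finprod G (\<lambda>x. x [^] e i x) B [^] d i \<otimes> finprod G (\<lambda>x. x [^] (\<Sum>i\<in>I. e i x * d i)) B"
    using insert assms by (subst finprod_insert) (auto simp: Pi_iff subset_iff)
  also have "finprod G (\<lambda>x. x [^] e i x) B [^] d i = finprod G (\<lambda>x. x [^] (e i x * d i)) B"
    using assms by (subst finprod_int_pow) (auto simp: int_pow_pow subset_iff intro!: finprod_cong')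
  also have "\<dots> \<otimes> finprod G (\<lambda>x. x [^] (\<Sum>i\<in>I. e i x * d i)) B
           = finprod G (\<lambda>x. x [^] (e i x * d i) \<otimes> x [^] (\<Sum>i\<in>I. e i x * d i)) B"
    using assms by (subst finprod_multf) (auto simp: subset_iff)
  also have "\<dots> = finprod G (\<lambda>x. x [^] (\<Sum>i\<in>insert i I. e i x * d i)) B"
    using assms insert by (intro finprod_cong') (auto simp: int_pow_mult subset_iff)
  finally show ?case .
qed

end

lemma hom_finprod_comm_group:
  assumes "comm_group G" "comm_group H" "f \<in> hom G H" "finite A" "g \<in> A \<rightarrow> carrier G"
  shows "f (finprod G g A) = finprod H (\<lambda>x. f (g x)) A"
proof -
  interpret G: comm_group G by fact
  interpret H: comm_group H by fact
  interpret group_hom G H f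
    using assms by (simp add: group_hom_def group_hom_axioms_def G.is_group H.is_group)
  show ?thesis
    using assms(4,5) by (induction A rule: finite_induct) (auto simp: Pi_iff)
qed

lemma hom_finprod_int_pow:
  assumes "comm_group G" "comm_group H" "f \<in> hom G H" "finite A" "g \<in> A \<rightarrow> carrier G"
  shows "f (finprod G (\<lambda>i. g i [^]\<^bsub>G\<^esub> (c i::int)) A) = finprod H (\<lambda>i. f (g i) [^]\<^bsub>H\<^esub> c i) A"
proof -
  interpret G: comm_group G by fact
  interpret H: comm_group H by fact
  interpret group_hom G H f
    using assms by (simp add: group_hom_def group_hom_axioms_def G.is_group H.is_group)
  have "f (finprod G (\<lambda>i. g i [^]\<^bsub>G\<^esub> c i) A) = finprod H (\<lambda>i. f (g i [^]\<^bsub>G\<^esub> c i)) A"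
    by (rule hom_finprod_comm_group) (use assms in auto)
  also have "\<dots> = finprod H (\<lambda>i. f (g i) [^]\<^bsub>H\<^esub> c i) A"
    using assms by (intro H.finprod_cong') (auto simp: hom_int_pow Pi_iff)
  finally show ?thesis .
qed

text \<open>Applying \<open>f\<close> to a relation kills the part on \<open>B\<close> and leaves a
  relation on \<open>C\<close>; once the coefficients on the lifts vanish, the rest is a relation on
  \<open>B\<close>. This bounds the rank from below in \<open>rank_nullity\<close>.\<close>

lemma int_independent_Un_section:
  assumes "comm_group G" "comm_group H" and f: "f \<in> hom G H"
    and B: "int_independent G B" "B \<subseteq> kernel G H f"
    and C: "int_independent H C" "s \<in> C \<rightarrow> carrier G" "\<And>c. c \<in> C \<Longrightarrow> f (s c) = c"
  shows "int_independent G (B \<union> s ` C)" "card (B \<union> s ` C) = card B + card C"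
proof -
  interpret G: comm_group G by fact
  interpret H: comm_group H by fact
  interpret group_hom G H f
    using f by (simp add: group_hom_def group_hom_axioms_def G.is_group H.is_group)
  have fin: "finite B" "finite C" and sub: "B \<subseteq> carrier G" "C \<subseteq> carrier H"
    using B C by (auto simp: int_independent_def)
  have inj: "inj_on s C"
    using C(3) by (metis inj_onI)
  \<comment> \<open>Elements of \<open>B\<close> map to the neutral element, so this makes
    \<open>B\<close> disjoint from the lifts of \<open>C\<close>.\<close>
  have one: "\<one>\<^bsub>H\<^esub> \<notin> C"
  proof
    assume "\<one>\<^bsub>H\<^esub> \<in> C"
    have "finprod H (\<lambda>b. b [^]\<^bsub>H\<^esub> (if b = \<one>\<^bsub>H\<^esub> then 1 else 0 :: int)) C = \<one>\<^bsub>H\<^esub>"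
      by (rule H.finprod_one_eqI) auto
    from int_independentD[OF C(1) this \<open>\<one>\<^bsub>H\<^esub> \<in> C\<close>] show False by simp
  qed
  have disj: "B \<inter> s ` C = {}"
    using one B(2) C(3) by (auto simp: kernel_def)
  show "card (B \<union> s ` C) = card B + card C"
    using disj fin card_image[OF inj] by (simp add: card_Un_disjoint)
  have "\<forall>b\<in>B \<union> s ` C. n b = 0"
    if *: "finprod G (\<lambda>b. b [^]\<^bsub>G\<^esub> n b) (B \<union> s ` C) = \<one>\<^bsub>G\<^esub>" for n :: "'a \<Rightarrow> int"
  proof -
    let ?P = "finprod G (\<lambda>b. b [^]\<^bsub>G\<^esub> n b)"
    have eq: "?P (B \<union> s ` C) = ?P B \<otimes>\<^bsub>G\<^esub> ?P (s ` C)"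
      by (rule G.finprod_Un_disjoint) (use fin disj sub C in \<open>auto simp: Pi_iff subset_iff\<close>)
    have clos: "?P B \<in> carrier G" "?P (s ` C) \<in> carrier G"
      using sub C by (auto intro!: G.finprod_closed simp: Pi_iff subset_iff)
    have "f (?P B) = finprod H (\<lambda>b. f b [^]\<^bsub>H\<^esub> n b) B"
      by (rule hom_finprod_int_pow) (use assms fin sub in auto)
    also have "\<dots> = \<one>\<^bsub>H\<^esub>"
      by (rule H.finprod_one_eqI) (use B in \<open>auto simp: kernel_def\<close>)
    finally have fB: "f (?P B) = \<one>\<^bsub>H\<^esub>" .
    have "\<one>\<^bsub>H\<^esub> = f (?P B \<otimes>\<^bsub>G\<^esub> ?P (s ` C))"
      using * eq by simp
    also have "\<dots> = f (?P (s ` C))"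
      using clos fB by simp
    also have "?P (s ` C) = finprod G (\<lambda>c. s c [^]\<^bsub>G\<^esub> n (s c)) C"
      by (rule G.finprod_reindex) (use C inj in \<open>auto simp: Pi_iff\<close>)
    also have "f \<dots> = finprod H (\<lambda>c. f (s c) [^]\<^bsub>H\<^esub> n (s c)) C"
      by (rule hom_finprod_int_pow) (use assms fin in auto)
    also have "\<dots> = finprod H (\<lambda>c. c [^]\<^bsub>H\<^esub> n (s c)) C"
      by (rule H.finprod_cong') (use C sub in auto)
    finally have nC: "\<forall>c\<in>C. n (s c) = 0"
      using C(1) unfolding int_independent_def by metis
    have "?P (s ` C) = \<one>\<^bsub>G\<^esub>"
      by (rule G.finprod_one_eqI) (use nC in auto)
    then have "?P B = \<one>\<^bsub>G\<^esub>"
      using * eq clos by simp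
    then have "\<forall>b\<in>B. n b = 0"
      using B(1) unfolding int_independent_def by metis
    then show ?thesis using nC by auto
  qed
  then show "int_independent G (B \<union> s ` C)"
    using fin sub C by (auto simp: int_independent_def)
qed

text \<open>A maximal subset of \<open>B\<close> with independent image gives \<open>C\<close>; each remaining element of \<open>B\<close> has
  a nonzero multiple that is moved into the kernel by a combination of that subset.\<close>

lemma int_independent_split:
  assumes "comm_group G" "comm_group H" and f: "f \<in> hom G H" and B: "int_independent G B"
  obtains D C where "int_independent G D" "D \<subseteq> kernel G H f"
    "int_independent H C" "C \<subseteq> f ` carrier G" "card B = card D + card C"
proof -
  interpret G: comm_group G by fact
  interpret H: comm_group H by fact
  interpret group_hom G H f
    using f by (simp add: group_hom_def group_hom_axioms_def G.is_group H.is_group)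
  have fin: "finite B" and sub: "B \<subseteq> carrier G"
    using B by (auto simp: int_independent_def)
  have fim: "f \<in> S \<rightarrow> carrier H" if "S \<subseteq> B" for S
    using that sub by auto
  let ?Q = "\<lambda>S. S \<subseteq> B \<and> int_independent_family H f S"
  have "?Q {}" by (simp add: int_independent_family_def)
  moreover have "\<forall>S. ?Q S \<longrightarrow> card S \<le> card B"
    using fin by (auto intro: card_mono)
  ultimately obtain S where S: "?Q S" and max: "\<And>T. ?Q T \<Longrightarrow> card T \<le> card S"
    using ex_has_greatest_nat[of ?Q "{}" card "Suc (card B)"] by (auto simp: less_Suc_eq_le)
  have finS: "finite S" using S fin finite_subset by auto
  have "\<exists>c :: 'a \<Rightarrow> int. c b \<noteq> 0 \<and> (\<forall>x. x \<notin> insert b S \<longrightarrow> c x = 0) \<and>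
          finprod G (\<lambda>x. x [^]\<^bsub>G\<^esub> c x) B \<in> kernel G H f" if b: "b \<in> B - S" for b
  proof -
    \<comment> \<open>By maximality of \<open>S\<close>, adding \<open>b\<close> creates a relation
      among the images; its coefficient at \<open>b\<close> is nonzero because \<open>S\<close>
      alone has independent images.\<close>
    have "\<not> ?Q (insert b S)"
      using max[of "insert b S"] b finS by auto
    moreover have "insert b S \<subseteq> B" "finite (insert b S)" using b S finS by auto
    moreover have "f \<in> insert b S \<rightarrow> carrier H" by (rule fim) fact
    ultimately have "\<not> (\<forall>c :: 'a \<Rightarrow> int. finprod H (\<lambda>x. f x [^]\<^bsub>H\<^esub> c x) (insert b S) = \<one>\<^bsub>H\<^esub>
        \<longrightarrow> (\<forall>x\<in>insert b S. c x = 0))"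
      unfolding int_independent_family_def by presburger
    then have "\<exists>c :: 'a \<Rightarrow> int. finprod H (\<lambda>x. f x [^]\<^bsub>H\<^esub> c x) (insert b S) = \<one>\<^bsub>H\<^esub>
        \<and> \<not> (\<forall>x\<in>insert b S. c x = 0)"
      by (simp only: not_all not_imp)
    then obtain c :: "'a \<Rightarrow> int" where
      c: "finprod H (\<lambda>x. f x [^]\<^bsub>H\<^esub> c x) (insert b S) = \<one>\<^bsub>H\<^esub>" "\<not> (\<forall>x\<in>insert b S. c x = 0)"
      by (elim exE conjE)
    define c' where "c' = (\<lambda>x. if x \<in> insert b S then c x else 0)"
    have "c b \<noteq> 0"
    proof
      assume "c b = 0"
      then have "finprod H (\<lambda>x. f x [^]\<^bsub>H\<^esub> c x) S = \<one>\<^bsub>H\<^esub>"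
        using c(1) b finS fim[of S] S sub by (subst (asm) H.finprod_insert) (auto simp: Pi_iff subset_iff)
      then have "\<forall>x\<in>S. c x = 0"
        using S by (auto simp: int_independent_family_def)
      then show False using c(2) \<open>c b = 0\<close> by auto
    qed
    moreover have "f (finprod G (\<lambda>x. x [^]\<^bsub>G\<^esub> c' x) B) = \<one>\<^bsub>H\<^esub>"
    proof -
      have "f (finprod G (\<lambda>x. x [^]\<^bsub>G\<^esub> c' x) B) = finprod H (\<lambda>x. f x [^]\<^bsub>H\<^esub> c' x) B"
        by (rule hom_finprod_int_pow) (use assms fin sub in auto)
      also have "\<dots> = finprod H (\<lambda>x. f x [^]\<^bsub>H\<^esub> c x) (insert b S)"
        by (rule H.finprod_mono_neutral_cong_right) (use b S fin sub fim in \<open>auto simp: c'_def\<close>)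
      finally show ?thesis using c by simp
    qed
    moreover have "finprod G (\<lambda>x. x [^]\<^bsub>G\<^esub> c' x) B \<in> carrier G"
      using sub by (auto intro!: G.finprod_closed)
    ultimately show ?thesis
      by (intro exI[of _ c']) (auto simp: c'_def kernel_def)
  qed
  then obtain e :: "'a \<Rightarrow> 'a \<Rightarrow> int" where
    e: "\<And>b. b \<in> B - S \<Longrightarrow> e b b \<noteq> 0" "\<And>b x. b \<in> B - S \<Longrightarrow> x \<notin> insert b S \<Longrightarrow> e b x = 0"
      "\<And>b. b \<in> B - S \<Longrightarrow> finprod G (\<lambda>x. x [^]\<^bsub>G\<^esub> e b x) B \<in> kernel G H f"
    by metis
  define k where "k = (\<lambda>b. finprod G (\<lambda>x. x [^]\<^bsub>G\<^esub> e b x) B)"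
  have k: "k ` (B - S) \<subseteq> kernel G H f"
    using e(3) by (auto simp: k_def)
  have "\<forall>b\<in>B - S. d b = 0"
    if "finprod G (\<lambda>b. k b [^]\<^bsub>G\<^esub> d b) (B - S) = \<one>\<^bsub>G\<^esub>" for d :: "'a \<Rightarrow> int"
  proof
    fix b assume b: "b \<in> B - S"
    have *: "finprod G (\<lambda>x. x [^]\<^bsub>G\<^esub> (\<Sum>b\<in>B - S. e b x * d b)) B = \<one>\<^bsub>G\<^esub>"
      using that fin sub by (simp add: k_def G.finprod_finprod_pow)
    have "(\<Sum>a\<in>B - S. e a b * d a) = 0"
      using int_independentD[OF B *, of b] b by simp
    \<comment> \<open>For \<open>a\<close> other than \<open>b\<close> the coefficient
      \<open>e a b\<close> vanishes, as \<open>b\<close> is not in \<open>S\<close>: restricted to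
      \<open>B - S\<close>, the matrix \<open>e\<close> is diagonal with nonzero diagonal.\<close>
    also have "(\<Sum>a\<in>B - S. e a b * d a) = (\<Sum>a\<in>{b}. e a b * d a)"
      by (rule sum.mono_neutral_right) (use fin b e(2) in auto)
    finally show "d b = 0" using e(1)[OF b] by simp
  qed
  then have kind: "int_independent_family G k (B - S)"
    using fin k by (auto simp: int_independent_family_def kernel_def)
  show thesis
  proof (rule that)
    show "int_independent G (k ` (B - S))" "k ` (B - S) \<subseteq> kernel G H f"
      using G.int_independent_image[OF kind] k by auto
    show "int_independent H (f ` S)" "f ` S \<subseteq> f ` carrier G"
      using H.int_independent_image S sub by auto
    show "card B = card (k ` (B - S)) + card (f ` S)"
      using G.int_independent_image[OF kind] H.int_independent_image[of f S] S fin finS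
      by (simp add: card_Diff_subset card_mono)
  qed
qed

lemma rank_of_upper: "B \<subseteq> S \<Longrightarrow> int_independent G B \<Longrightarrow> enat (card B) \<le> rank_of G S"
  unfolding rank_of_def by (rule SUP_upper) auto

lemma rank_of_mono: "S \<subseteq> T \<Longrightarrow> rank_of G S \<le> rank_of G T"
  unfolding rank_of_def by (rule SUP_subset_mono) auto

lemma int_independent_empty: "int_independent G {}"
  by (simp add: int_independent_def)

text \<open>A finite supremum is taken over finitely many sizes, and the empty set provides at least
  one, so it is a maximum.\<close>

lemma rank_of_attained:
  assumes "rank_of G S = enat r"
  obtains B where "B \<subseteq> S" "int_independent G B" "card B = r"
proof -
  let ?A = "(\<lambda>B. enat (card B)) ` {B. B \<subseteq> S \<and> int_independent G B}"
  have ne: "?A \<noteq> {}" using int_independent_empty by auto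
  have "finite ?A"
  proof -
    have "?A \<subseteq> enat ` {..r}"
      using rank_of_upper[of _ S G] assms by fastforce
    then show ?thesis by (rule finite_subset) auto
  qed
  then have "Sup ?A \<in> ?A"
    using ne by (metis Sup_enat_def Max_in)
  then show thesis
    using assms that by (auto simp: rank_of_def)
qed

lemma has_rank_iff: "has_rank G r \<longleftrightarrow> rank_of G (carrier G) = enat r"
proof
  assume "has_rank G r"
  then obtain B where B: "int_independent G B" "card B = r" "\<And>B. int_independent G B \<Longrightarrow> card B \<le> r"
    unfolding has_rank_def by blast
  have "rank_of G (carrier G) \<le> enat r"
    unfolding rank_of_def using B by (auto intro!: SUP_least)
  moreover have "enat r \<le> rank_of G (carrier G)"
    using B rank_of_upper[of B "carrier G" G] by (auto simp: int_independent_def)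
  ultimately show "rank_of G (carrier G) = enat r" by simp
next
  assume r: "rank_of G (carrier G) = enat r"
  then obtain B where "int_independent G B" "card B = r"
    by (rule rank_of_attained)
  moreover have "card B \<le> r" if "int_independent G B" for B
    using rank_of_upper[of B "carrier G" G] that r by (auto simp: int_independent_def)
  ultimately show "has_rank G r" unfolding has_rank_def by blast
qed

text \<open>The upper bound splits an independent set with \<open>int_independent_split\<close>. For
  the lower bound only finite rank of \<open>G\<close> matters; kernel and image then have finite
  rank too, attained by independent sets, and \<open>int_independent_Un_section\<close> combines
  these.\<close>

theorem rank_nullity:
  assumes "comm_group G" "comm_group H" and f: "f \<in> hom G H"
  shows "rank_of G (carrier G) = rank_of G (kernel G H f) + rank_of H (f ` carrier G)"
proof (rule antisym)
  show "rank_of G (carrier G) \<le> rank_of G (kernel G H f) + rank_of H (f ` carrier G)"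
    unfolding rank_of_def[of G "carrier G"]
  proof (rule SUP_least)
    fix B assume "B \<in> {B. B \<subseteq> carrier G \<and> int_independent G B}"
    then obtain D C where DC: "int_independent G D" "D \<subseteq> kernel G H f"
      "int_independent H C" "C \<subseteq> f ` carrier G" "card B = card D + card C"
      using int_independent_split[OF assms, of B] by auto
    show "enat (card B) \<le> rank_of G (kernel G H f) + rank_of H (f ` carrier G)"
      using add_mono[OF rank_of_upper[OF DC(2,1)] rank_of_upper[OF DC(4,3)]] DC(5) by simp
  qed
next
  show "rank_of G (kernel G H f) + rank_of H (f ` carrier G) \<le> rank_of G (carrier G)"
  proof (cases "rank_of G (carrier G)")
    case (enat r)
    have ker: "kernel G H f \<subseteq> carrier G" by (auto simp: kernel_def)
    have comb: "enat (card B + card C) \<le> rank_of G (carrier G)"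
      if B: "B \<subseteq> kernel G H f" "int_independent G B" and C: "C \<subseteq> f ` carrier G" "int_independent H C"
      for B C
    proof -
      have "\<forall>c\<in>C. \<exists>x. x \<in> carrier G \<and> f x = c"
        using C(1) by blast
      then obtain s where s: "\<And>c. c \<in> C \<Longrightarrow> s c \<in> carrier G \<and> f (s c) = c"
        by (auto dest!: bchoice)
      have *: "int_independent G (B \<union> s ` C)" "card (B \<union> s ` C) = card B + card C"
        using int_independent_Un_section[OF assms B(2,1) C(2), of s] s by auto
      then show ?thesis
        using rank_of_upper[OF _ *(1), of "carrier G"] by (auto simp: int_independent_def)
    qed
    have "rank_of H (f ` carrier G) \<le> enat r"
      unfolding rank_of_def[of H]
    proof (rule SUP_least)
      fix C assume "C \<in> {B. B \<subseteq> f ` carrier G \<and> int_independent H B}"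
      then show "enat (card C) \<le> enat r"
        using comb[of "{}" C] enat int_independent_empty[of G] by simp
    qed
    then obtain q where q: "rank_of H (f ` carrier G) = enat q"
      by (cases "rank_of H (f ` carrier G)") auto
    obtain p where p: "rank_of G (kernel G H f) = enat p"
      using rank_of_mono[OF ker, of G] enat by (cases "rank_of G (kernel G H f)") auto
    obtain B where "B \<subseteq> kernel G H f" "int_independent G B" "card B = p"
      using p by (rule rank_of_attained)
    moreover obtain C where "C \<subseteq> f ` carrier G" "int_independent H C" "card C = q"
      using q by (rule rank_of_attained)
    ultimately show ?thesis
      using comb[of B C] p q by simp
  qed auto
qed

lemma rank_of_trivial:
  assumes "comm_group G" "S \<subseteq> {\<one>\<^bsub>G\<^esub>}"
  shows "rank_of G S = 0"
proof -
  interpret comm_group G by fact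
  have "card B = 0" if "B \<subseteq> S" "int_independent G B" for B
  proof (rule ccontr)
    assume "card B \<noteq> 0"
    then have B: "\<one>\<^bsub>G\<^esub> \<in> B" using that assms by (auto dest!: subset_singletonD)
    have "finprod G (\<lambda>b. b [^]\<^bsub>G\<^esub> (1::int)) B = \<one>\<^bsub>G\<^esub>"
      using that assms by (intro finprod_one_eqI) auto
    from int_independentD[OF that(2) this B] show False by simp
  qed
  then have "rank_of G S \<le> 0"
    unfolding rank_of_def by (intro SUP_least) (auto simp: zero_enat_def)
  then show ?thesis by simp
qed

lemma rank_of_iso:
  assumes "comm_group G" "comm_group H" "f \<in> iso G H"
  shows "rank_of G (carrier G) = rank_of H (carrier H)"
proof -
  interpret G: comm_group G by fact
  interpret H: comm_group H by fact
  have f: "f \<in> hom G H" using assms by (simp add: iso_def)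
  interpret group_hom G H f
    using f by (simp add: group_hom_def group_hom_axioms_def G.is_group H.is_group)
  have "kernel G H f = {\<one>\<^bsub>G\<^esub>}"
    using assms(3) inj_iff_trivial_ker by (auto simp: iso_def bij_betw_def)
  then show ?thesis
    using rank_nullity[OF assms(1,2) f] assms(3) rank_of_trivial[OF assms(1), of "kernel G H f"]
    by (auto simp: iso_def bij_betw_def)
qed

lemma rank_of_integer_group: "rank_of integer_group UNIV = 1"
proof (rule antisym)
  interpret comm_group integer_group by (rule abelian_integer_group)
  have "card B \<le> 1" if "int_independent integer_group B" for B
  proof (rule ccontr)
    assume "\<not> card B \<le> 1"
    then obtain a b where ab: "a \<in> B" "b \<in> B" "a \<noteq> b"
      by (metis card_le_Suc0_iff_eq card.infinite One_nat_def le0)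
    have fin: "finite B" using that by (simp add: int_independent_def)
    \<comment> \<open>Two distinct integers satisfy the relation b a - a b = 0, whose coefficients
      do not both vanish.\<close>
    define c :: "int \<Rightarrow> int" where "c = (\<lambda>x. if x = a then b else if x = b then - a else 0)"
    have "finprod integer_group (\<lambda>x. x [^]\<^bsub>integer_group\<^esub> c x) B
        = finprod integer_group (\<lambda>x. x [^]\<^bsub>integer_group\<^esub> c x) {a, b}"
      by (rule finprod_mono_neutral_cong_right) (use fin ab in \<open>auto simp: c_def\<close>)
    also have "\<dots> = \<one>\<^bsub>integer_group\<^esub>"
      using ab by (subst finprod_insert) (auto simp: c_def)
    finally have *: "finprod integer_group (\<lambda>x. x [^]\<^bsub>integer_group\<^esub> c x) B = \<one>\<^bsub>integer_group\<^esub>" .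
    show False
      using int_independentD[OF that * ab(1)] int_independentD[OF that * ab(2)] ab
      by (auto simp: c_def split: if_splits)
  qed
  then show "rank_of integer_group UNIV \<le> 1"
    unfolding rank_of_def by (intro SUP_least) (auto simp: one_enat_def)
  have "int_independent integer_group {1}"
    by (simp add: int_independent_def)
  from rank_of_upper[OF _ this] show "1 \<le> rank_of integer_group UNIV"
    by (simp add: one_enat_def)
qed

section \<open>Euler characteristics of pairs\<close>

text \<open>The arithmetic content of \<open>has_euler_characteristic\<close>, separated from
  homology so that sums, shifts and comparisons of sequences can be treated on their own.\<close>

definition alternating_sum :: "(nat \<Rightarrow> enat) \<Rightarrow> int \<Rightarrow> bool" where
  "alternating_sum a k \<longleftrightarrow>
     (\<exists>b. (\<forall>p. a p = enat (b p)) \<and> finite {p. b p \<noteq> 0} \<and>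
          k = (\<Sum>p | b p \<noteq> 0. (-1) ^ p * int (b p)))"

text \<open>Summing up to a bound instead of over the support lets different sequences share one
  range of summation.\<close>

lemma alternating_sum_iff:
  "alternating_sum a k \<longleftrightarrow>
     (\<exists>b N. (\<forall>p. a p = enat (b p)) \<and> (\<forall>p\<ge>N. b p = 0) \<and> k = (\<Sum>p<N. (-1) ^ p * int (b p)))"
    (is "?L \<longleftrightarrow> ?R")
proof
  assume ?L
  then obtain b where b: "\<forall>p. a p = enat (b p)" "finite {p. b p \<noteq> 0}"
    "k = (\<Sum>p | b p \<noteq> 0. (-1) ^ p * int (b p))"
    unfolding alternating_sum_def by blast
  then obtain N where N: "{p. b p \<noteq> 0} \<subseteq> {..<N}"
    using finite_nat_iff_bounded by auto
  have "(\<Sum>p<N. (-1) ^ p * int (b p)) = k"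
    unfolding b(3) by (rule sum.mono_neutral_right) (use N in auto)
  moreover have "\<forall>p\<ge>N. b p = 0" using N by auto
  ultimately show ?R using b(1) by blast
next
  assume ?R
  then obtain b N where b: "\<forall>p. a p = enat (b p)" "\<forall>p\<ge>N. b p = 0"
    "k = (\<Sum>p<N. (-1) ^ p * int (b p))" by blast
  have sub: "{p. b p \<noteq> 0} \<subseteq> {..<N}" using b(2) by (metis (mono_tags, lifting) lessThan_iff linorder_not_le mem_Collect_eq subsetI)
  have "k = (\<Sum>p | b p \<noteq> 0. (-1) ^ p * int (b p))"
    unfolding b(3) by (rule sum.mono_neutral_right) (use sub in auto)
  then show ?L
    unfolding alternating_sum_def using b(1) finite_subset[OF sub] by blast
qed

lemma alternating_sumE:
  assumes "alternating_sum a k"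
  obtains b N where "a = (\<lambda>p. enat (b p))" "\<And>M. M \<ge> N \<Longrightarrow> k = (\<Sum>p<M. (-1) ^ p * int (b p))"
    "\<And>p. p \<ge> N \<Longrightarrow> b p = 0"
proof -
  obtain b N where b: "\<forall>p. a p = enat (b p)" "\<forall>p\<ge>N. b p = 0" "k = (\<Sum>p<N. (-1) ^ p * int (b p))"
    using assms by (auto simp: alternating_sum_iff)
  show thesis
  proof
    show "a = (\<lambda>p. enat (b p))" using b by auto
    fix M assume "M \<ge> N"
    show "k = (\<Sum>p<M. (-1) ^ p * int (b p))"
      unfolding b(3) by (rule sum.mono_neutral_left) (use b(2) \<open>M \<ge> N\<close> in auto)
  qed (use b in auto)
qed

lemma alternating_sumI:
  assumes "\<And>p. p \<ge> N \<Longrightarrow> b p = 0" "k = (\<Sum>p<N. (-1) ^ p * int (b p))"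
  shows "alternating_sum (\<lambda>p. enat (b p)) k"
  using assms by (auto simp: alternating_sum_iff)

lemma alternating_sum_add:
  assumes "alternating_sum f k" "alternating_sum g l"
  shows "alternating_sum (\<lambda>p. f p + g p) (k + l)"
proof -
  obtain b N where b: "f = (\<lambda>p. enat (b p))" "\<And>M. M \<ge> N \<Longrightarrow> k = (\<Sum>p<M. (-1) ^ p * int (b p))"
    "\<And>p. p \<ge> N \<Longrightarrow> b p = 0" using assms(1) by (rule alternating_sumE) blast
  obtain c M where c: "g = (\<lambda>p. enat (c p))" "\<And>K. K \<ge> M \<Longrightarrow> l = (\<Sum>p<K. (-1) ^ p * int (c p))"
    "\<And>p. p \<ge> M \<Longrightarrow> c p = 0" using assms(2) by (rule alternating_sumE) blast
  have "alternating_sum (\<lambda>p. enat (b p + c p)) (k + l)"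
  proof (rule alternating_sumI[where N = "max N M"])
    show "k + l = (\<Sum>p<max N M. (-1) ^ p * int (b p + c p))"
      using b(2)[of "max N M"] c(2)[of "max N M"] by (simp add: sum.distrib algebra_simps)
  qed (use b c in auto)
  then show ?thesis by (simp add: b(1) c(1))
qed

lemma alternating_sum_shift:
  assumes "alternating_sum f k"
  shows "alternating_sum (\<lambda>p. if p = 0 then 0 else f (p - 1)) (- k)"
proof -
  obtain b N where b: "f = (\<lambda>p. enat (b p))" "\<And>M. M \<ge> N \<Longrightarrow> k = (\<Sum>p<M. (-1) ^ p * int (b p))"
    "\<And>p. p \<ge> N \<Longrightarrow> b p = 0" using assms(1) by (rule alternating_sumE) blast
  have "alternating_sum (\<lambda>p. enat (if p = 0 then 0 else b (p - 1))) (- k)"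
  proof (rule alternating_sumI[where N = "Suc N"])
    show "- k = (\<Sum>p<Suc N. (-1) ^ p * int (if p = 0 then 0 else b (p - 1)))"
      using b(2)[of N] by (subst sum.lessThan_Suc_shift) (simp add: sum_negf)
  qed (use b in auto)
  also have "(\<lambda>p. enat (if p = 0 then 0 else b (p - 1))) = (\<lambda>p. if p = 0 then 0 else f (p - 1))"
    by (auto simp: b(1) zero_enat_def)
  finally show ?thesis .
qed

text \<open>This provides alternating sums for the pieces of an exact sequence, each of which is
  bounded by a term whose sum is known to exist.\<close>

lemma alternating_sum_dominated:
  assumes "alternating_sum g l" "\<And>p. f p \<le> g p"
  obtains k where "alternating_sum f k"
proof -
  obtain c N where c: "g = (\<lambda>p. enat (c p))" "\<And>p. p \<ge> N \<Longrightarrow> c p = 0"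
    using assms(1) by (rule alternating_sumE) blast
  have "\<exists>b. f p = enat b" for p
    using assms(2)[of p] c(1) by (cases "f p") auto
  then obtain b where b: "\<And>p. f p = enat (b p)" by metis
  have "b p = 0" if "p \<ge> N" for p
    using assms(2)[of p] b c that by simp
  then have "alternating_sum (\<lambda>p. enat (b p)) (\<Sum>p<N. (-1) ^ p * int (b p))"
    by (rule alternating_sumI) auto
  moreover have "f = (\<lambda>p. enat (b p))" using b by auto
  ultimately show thesis using that by metis
qed

lemma alternating_sum_unique:
  assumes "alternating_sum f k" "alternating_sum f l"
  shows "k = l"
proof -
  obtain b N where b: "f = (\<lambda>p. enat (b p))" "\<And>M. M \<ge> N \<Longrightarrow> k = (\<Sum>p<M. (-1) ^ p * int (b p))"
    using assms(1) by (rule alternating_sumE) blast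
  obtain c M where c: "f = (\<lambda>p. enat (c p))" "\<And>K. K \<ge> M \<Longrightarrow> l = (\<Sum>p<K. (-1) ^ p * int (c p))"
    using assms(2) by (rule alternating_sumE) blast
  have "b = c" using b(1) c(1) by (metis enat.inject ext)
  then show ?thesis using b(2)[of "max N M"] c(2)[of "max N M"] by simp
qed

section \<open>Betti numbers of pairs and the long exact sequence\<close>

definition betti :: "'a topology \<Rightarrow> 'a set \<Rightarrow> int \<Rightarrow> enat" where
  "betti X S p = rank_of (relative_homology_group p X S) (carrier (relative_homology_group p X S))"

definition euler_pair :: "'a topology \<Rightarrow> 'a set \<Rightarrow> int \<Rightarrow> bool" where
  "euler_pair X S k \<longleftrightarrow> alternating_sum (\<lambda>p. betti X S (int p)) k"

lemma has_euler_characteristic_iff: "has_euler_characteristic X k \<longleftrightarrow> euler_pair X {} k"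
  by (simp add: has_euler_characteristic_def euler_pair_def alternating_sum_def betti_def has_rank_iff)

text \<open>Rank-nullity splits each group into the kernel and the image of the map leaving it.
  Exactness identifies these pieces: \<open>\<alpha>\<close> belongs to the kernel of
  \<open>i\<close>, \<open>\<beta>\<close> to the image of \<open>i\<close> and
  \<open>\<gamma>\<close> to the image of \<open>j\<close>, while the image of the boundary map is
  the kernel of \<open>i\<close> one degree lower.\<close>

lemma betti_exact_sequence:
  obtains \<alpha> \<beta> \<gamma> :: "nat \<Rightarrow> enat" where
    "\<And>p. betti (subtopology X S) {} (int p) = \<alpha> p + \<beta> p"
    "\<And>p. betti X {} (int p) = \<beta> p + \<gamma> p"
    "\<And>p. betti X S (int p) = \<gamma> p + (if p = 0 then 0 else \<alpha> (p - 1))"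
proof -
  define A where "A = (\<lambda>p. homology_group p (subtopology X S))"
  define B where "B = (\<lambda>p. homology_group p X)"
  define R where "R = (\<lambda>p. relative_homology_group p X S)"
  define i where "i = (\<lambda>p. hom_induced p (subtopology X S) {} X {} id)"
  define j where "j = (\<lambda>p. hom_induced p X {} X S id)"
  define d where "d = (\<lambda>p. hom_boundary p X S)"
  note defs = A_def B_def R_def i_def j_def d_def
  have comm: "comm_group (A p)" "comm_group (B p)" "comm_group (R p)" for p
    by (auto simp: defs abelian_relative_homology_group)
  have hom: "i p \<in> hom (A p) (B p)" "j p \<in> hom (B p) (R p)" "d p \<in> hom (R p) (A (p - 1))" for p
    by (simp_all add: defs hom_induced_hom hom_boundary_hom)
  have ex1: "kernel (R p) (A (p - 1)) (d p) = j p ` carrier (B p)" for p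
    using homology_exactness_axiom_1[of p X S] by (simp add: defs)
  have ex2: "kernel (A (p - 1)) (B (p - 1)) (i (p - 1)) = d p ` carrier (R p)" for p
    using homology_exactness_axiom_2[of p X S] by (simp add: defs)
  have ex3: "kernel (B p) (R p) (j p) = i p ` carrier (A p)" for p
    using homology_exactness_axiom_3[of p X S] by (simp add: defs)
  define \<alpha> where "\<alpha> = (\<lambda>p. rank_of (A (int p)) (kernel (A (int p)) (B (int p)) (i (int p))))"
  define \<beta> where "\<beta> = (\<lambda>p. rank_of (B (int p)) (i (int p) ` carrier (A (int p))))"
  define \<gamma> where "\<gamma> = (\<lambda>p. rank_of (R (int p)) (j (int p) ` carrier (B (int p))))"
  show thesis
  proof
    fix p :: nat
    show "betti (subtopology X S) {} (int p) = \<alpha> p + \<beta> p"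
      using rank_nullity[OF comm(1,2) hom(1), of "int p"] by (simp add: betti_def \<alpha>_def \<beta>_def defs)
    show "betti X {} (int p) = \<beta> p + \<gamma> p"
      using rank_nullity[OF comm(2,3) hom(2), of "int p"] ex3[of "int p"]
      by (simp add: betti_def \<gamma>_def \<beta>_def defs)
    have R: "betti X S (int p) = \<gamma> p + rank_of (A (int p - 1)) (d (int p) ` carrier (R (int p)))"
      using rank_nullity[OF comm(3) comm(1) hom(3), of "int p"] ex1[of "int p"]
      by (simp add: betti_def \<gamma>_def defs)
    show "betti X S (int p) = \<gamma> p + (if p = 0 then 0 else \<alpha> (p - 1))"
    proof (cases "p = 0")
      case True
      \<comment> \<open>In degree 0 the boundary map lands in degree -1, where homology
        vanishes.\<close>
      have "d 0 ` carrier (R 0) \<subseteq> carrier (A (- 1))"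
        using hom(3)[of 0] by (auto simp: hom_def)
      also have "\<dots> \<subseteq> {\<one>\<^bsub>A (- 1)\<^esub>}"
        using trivial_relative_homology_group[of "-1" "subtopology X S" "{}"]
        by (auto simp: A_def trivial_group_def)
      finally show ?thesis
        using R True rank_of_trivial[OF comm(1)] by simp
    next
      case False
      then have "int p - 1 = int (p - 1)" by simp
      then show ?thesis
        using R ex2[of "int p"] False by (simp add: \<alpha>_def)
    qed
  qed
qed

text \<open>If a, b, c are the alternating sums of \<open>\<alpha>\<close>, \<open>\<beta>\<close>,
  \<open>\<gamma>\<close>, then subspace, space and pair have the sums a + b, b + c and c - a; the
  minus sign comes from the shift by one degree.\<close>

lemma euler_pair_relative:
  assumes "euler_pair (subtopology X S) {} k" "euler_pair X {} l"
  shows "euler_pair X S (l - k)"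
proof -
  obtain \<alpha> \<beta> \<gamma> :: "nat \<Rightarrow> enat" where *:
    "\<And>p. betti (subtopology X S) {} (int p) = \<alpha> p + \<beta> p"
    "\<And>p. betti X {} (int p) = \<beta> p + \<gamma> p"
    "\<And>p. betti X S (int p) = \<gamma> p + (if p = 0 then 0 else \<alpha> (p - 1))"
    using betti_exact_sequence[of X S] by blast
  have A: "alternating_sum (\<lambda>p. \<alpha> p + \<beta> p) k" and X: "alternating_sum (\<lambda>p. \<beta> p + \<gamma> p) l"
    using assms by (simp_all add: euler_pair_def *)
  obtain a where a: "alternating_sum \<alpha> a"
    using alternating_sum_dominated[OF A, of \<alpha>] by auto
  obtain b where b: "alternating_sum \<beta> b"
    using alternating_sum_dominated[OF A, of \<beta>] by auto
  obtain c where c: "alternating_sum \<gamma> c"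
    using alternating_sum_dominated[OF X, of \<gamma>] by auto
  have "k = a + b" "l = b + c"
    using alternating_sum_unique[OF A alternating_sum_add[OF a b]]
      alternating_sum_unique[OF X alternating_sum_add[OF b c]] by auto
  then show ?thesis
    using alternating_sum_add[OF c alternating_sum_shift[OF a]] by (simp add: euler_pair_def *)
qed

lemma euler_pair_total:
  assumes "euler_pair (subtopology X S) {} k" "euler_pair X S m"
  shows "euler_pair X {} (k + m)"
proof -
  obtain \<alpha> \<beta> \<gamma> :: "nat \<Rightarrow> enat" where *:
    "\<And>p. betti (subtopology X S) {} (int p) = \<alpha> p + \<beta> p"
    "\<And>p. betti X {} (int p) = \<beta> p + \<gamma> p"
    "\<And>p. betti X S (int p) = \<gamma> p + (if p = 0 then 0 else \<alpha> (p - 1))"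
    using betti_exact_sequence[of X S] by blast
  have A: "alternating_sum (\<lambda>p. \<alpha> p + \<beta> p) k"
    and R: "alternating_sum (\<lambda>p. \<gamma> p + (if p = 0 then 0 else \<alpha> (p - 1))) m"
    using assms by (simp_all add: euler_pair_def *)
  obtain a where a: "alternating_sum \<alpha> a"
    using alternating_sum_dominated[OF A, of \<alpha>] by auto
  obtain b where b: "alternating_sum \<beta> b"
    using alternating_sum_dominated[OF A, of \<beta>] by auto
  obtain c where c: "alternating_sum \<gamma> c"
    using alternating_sum_dominated[OF R, of \<gamma>] by auto
  have "k = a + b" "m = c - a"
    using alternating_sum_unique[OF A alternating_sum_add[OF a b]]
      alternating_sum_unique[OF R alternating_sum_add[OF c alternating_sum_shift[OF a]]] by auto
  then show ?thesis
    using alternating_sum_add[OF b c] by (simp add: euler_pair_def *)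
qed

lemma euler_pair_iso:
  assumes "\<And>p. relative_homology_group p X S \<cong> relative_homology_group p Y T" "euler_pair X S k"
  shows "euler_pair Y T k"
proof -
  have "betti X S p = betti Y T p" for p
  proof -
    obtain f where "f \<in> iso (relative_homology_group p X S) (relative_homology_group p Y T)"
      using assms(1)[of p] by (auto simp: is_iso_def)
    then show ?thesis
      unfolding betti_def
      by (rule rank_of_iso[OF abelian_relative_homology_group abelian_relative_homology_group])
  qed
  then show ?thesis using assms(2) by (simp add: euler_pair_def)
qed

lemma euler_pair_homotopy_equivalent:
  assumes "X homotopy_equivalent_space Y" "euler_pair X {} k"
  shows "euler_pair Y {} k"
  by (rule euler_pair_iso[OF homotopy_equivalent_space_imp_isomorphic_homology_groups[OF assms(1)] assms(2)])

text \<open>The complement of \<open>B\<close> is closed and lies in the open set \<open>A\<close>.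
  Excising it identifies the pair of \<open>X\<close> and \<open>A\<close> with the pair of
  \<open>B\<close> and \<open>A \<inter> B\<close>, which has Euler characteristic b - c; the exact
  sequence of the first pair then adds a.\<close>

lemma euler_pair_open_cover:
  assumes "openin X A" "openin X B" "A \<union> B = topspace X"
    and "euler_pair (subtopology X A) {} a" "euler_pair (subtopology X B) {} b"
    and "euler_pair (subtopology X (A \<inter> B)) {} c"
  shows "euler_pair X {} (a + b - c)"
proof -
  let ?U = "topspace X - B"
  have sub: "A \<subseteq> topspace X" "B \<subseteq> topspace X"
    using assms by (auto dest: openin_subset)
  have "closedin X ?U" using assms(2) by blast
  then have "X closure_of ?U = ?U" by (rule closure_of_closedin)
  moreover have "X interior_of A = A" using assms(1) by (rule interior_of_openin)
  ultimately have cl: "X closure_of ?U \<subseteq> X interior_of A" using assms(3) by auto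
  have *: "topspace X - ?U = B" "A - ?U = A \<inter> B" "subtopology X (topspace X) = X"
    using sub by auto
  have iso: "relative_homology_group p (subtopology X B) (A \<inter> B) \<cong> relative_homology_group p X A" for p
    using is_isoI[OF homology_excision_axiom[OF cl sub(1), of p]] unfolding * .
  have "euler_pair (subtopology (subtopology X B) (A \<inter> B)) {} c"
    using assms(6) unfolding subtopology_subtopology by (metis Int_left_commute Int_absorb)
  from euler_pair_relative[OF this assms(5)] have "euler_pair (subtopology X B) (A \<inter> B) (b - c)" .
  then have "euler_pair X A (b - c)"
    by (rule euler_pair_iso[OF iso])
  from euler_pair_total[OF assms(4) this] show ?thesis by (simp add: algebra_simps)
qed

lemma euler_pair_empty:
  assumes "topspace X = {}"
  shows "euler_pair X {} 0"
proof -
  have "betti X {} (int p) = 0" for p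
    unfolding betti_def
    by (rule rank_of_trivial)
      (use trivial_homology_group_empty[OF assms, of "int p"] in
        \<open>auto simp: trivial_group_def abelian_relative_homology_group\<close>)
  then show ?thesis
    using alternating_sumI[of 0 "\<lambda>_. 0" 0] by (simp add: euler_pair_def zero_enat_def)
qed

lemma euler_pair_singleton:
  assumes "topspace X = {x}"
  shows "euler_pair X {} 1"
proof -
  have "betti X {} (int p) = enat (if p = 0 then 1 else 0)" for p
  proof (cases "p = 0")
    case True
    have "path_connected_space X" "topspace X \<noteq> {}"
      using assms path_connectedin_topspace[of X] path_connectedin_singleton[of X x] by auto
    then have "homology_group 0 X \<cong> integer_group"
      by (simp add: isomorphic_integer_zeroth_homology_group)
    then obtain f where "f \<in> iso (homology_group 0 X) integer_group"
      by (auto simp: is_iso_def)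
    then have "rank_of (homology_group 0 X) (carrier (homology_group 0 X)) = rank_of integer_group UNIV"
      using rank_of_iso[OF abelian_homology_group abelian_integer_group] by simp
    then show ?thesis
      using True by (simp add: betti_def rank_of_integer_group one_enat_def)
  next
    case False
    then have "trivial_group (homology_group (int p) X)"
      using homology_dimension_axiom[OF assms, of "int p"] by simp
    then have "betti X {} (int p) = 0"
      unfolding betti_def
      by (intro rank_of_trivial) (auto simp: trivial_group_def abelian_relative_homology_group)
    then show ?thesis using False by (simp add: zero_enat_def)
  qed
  then show ?thesis
    using alternating_sumI[of 1 "\<lambda>p. if p = 0 then 1 else 0" 1] by (simp add: euler_pair_def)
qed

section \<open>Real moment-angle complexes\<close>

definition free_coords :: "(nat \<Rightarrow> real) \<Rightarrow> nat set" where
  "free_coords x = {i. \<bar>x i\<bar> \<noteq> 1}"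

text \<open>Pinning the coordinates from \<open>n\<close> on to 1 puts the complexes for all
  \<open>n\<close> into one space and lets an induction lower \<open>n\<close> while keeping
  \<open>K\<close>: the restriction of \<open>K\<close> to subsets of \<open>{..<n}\<close> is
  automatic.\<close>

definition moment_angle :: "nat \<Rightarrow> nat set set \<Rightarrow> (nat \<Rightarrow> real) set" where
  "moment_angle n K = {x. (\<forall>i. \<bar>x i\<bar> \<le> 1) \<and> (\<forall>i\<ge>n. x i = 1) \<and> free_coords x \<in> K}"

definition down_closed :: "'a set set \<Rightarrow> bool" where
  "down_closed K \<longleftrightarrow> (\<forall>s\<in>K. \<forall>t. t \<subseteq> s \<longrightarrow> t \<in> K)"

lemma down_closedD: "down_closed K \<Longrightarrow> s \<in> K \<Longrightarrow> t \<subseteq> s \<Longrightarrow> t \<in> K"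
  by (auto simp: down_closed_def)

lemma free_coords_subset: "x \<in> moment_angle n K \<Longrightarrow> free_coords x \<subseteq> {..<n}"
  by (force simp: moment_angle_def free_coords_def not_less[symmetric])

lemma continuous_on_coordinate: "continuous_on S (\<lambda>x :: nat \<Rightarrow> real. x i)"
  using continuous_on_product_coordinates[of i] continuous_on_subset by blast

lemma continuous_on_fun_upd:
  fixes f :: "'a::topological_space \<Rightarrow> nat \<Rightarrow> real"
  assumes "\<And>i. i \<noteq> n \<Longrightarrow> continuous_on S (\<lambda>x. f x i)" "continuous_on S g"
  shows "continuous_on S (\<lambda>x. (f x)(n := g x))"
proof (rule continuous_on_coordinatewise_then_product)
  fix i show "continuous_on S (\<lambda>x. ((f x)(n := g x)) i)"
    by (cases "i = n") (use assms in auto)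
qed

text \<open>\<open>Y\<close> is deformed along coordinate \<open>n\<close> into its slice at height
  \<open>c\<close>, which becomes \<open>Z\<close> when that coordinate is reset to 1. The value c
  is 1 or -1 for the two halves of the complex and 0 for their intersection.\<close>

lemma homotopy_equivalent_straighten:
  fixes Y Z :: "(nat \<Rightarrow> real) set"
  assumes "\<And>x. x \<in> Y \<Longrightarrow> x(n := 1) \<in> Z" "\<And>z. z \<in> Z \<Longrightarrow> z(n := c) \<in> Y" "\<And>z. z \<in> Z \<Longrightarrow> z n = 1"
    and "\<And>x t. x \<in> Y \<Longrightarrow> t \<in> {0..1} \<Longrightarrow> x(n := (1 - t) * c + t * x n) \<in> Y"
  shows "top_of_set Y homotopy_equivalent_space top_of_set Z"
  unfolding homotopy_equivalent_space_def
proof (intro exI conjI)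
  let ?f = "\<lambda>x :: nat \<Rightarrow> real. x(n := 1)" and ?g = "\<lambda>z :: nat \<Rightarrow> real. z(n := c)"
  show f: "continuous_map (top_of_set Y) (top_of_set Z) ?f"
    using assms(1) by (auto intro!: continuous_on_fun_upd continuous_on_coordinate)
  show g: "continuous_map (top_of_set Z) (top_of_set Y) ?g"
    using assms(2) by (auto intro!: continuous_on_fun_upd continuous_on_coordinate)
  show "homotopic_with (\<lambda>x. True) (top_of_set Z) (top_of_set Z) (?f \<circ> ?g) id"
    by (rule homotopic_with_equal) (use assms(3) continuous_map_compose[OF g f] in auto)
  show "homotopic_with (\<lambda>x. True) (top_of_set Y) (top_of_set Y) (?g \<circ> ?f) id"
    unfolding homotopic_with_def
  proof (intro exI conjI allI ballI TrueI)
    let ?h = "\<lambda>(t, x :: nat \<Rightarrow> real). x(n := (1 - t) * c + t * x n)"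
    have "continuous_on ({0..1} \<times> Y) (\<lambda>p. (snd p)(n := (1 - fst p) * c + fst p * snd p n))"
      by (intro continuous_on_fun_upd continuous_intros continuous_on_compose2[OF continuous_on_coordinate])
        auto
    moreover have "?h = (\<lambda>p. (snd p)(n := (1 - fst p) * c + fst p * snd p n))"
      by auto
    ultimately show "continuous_map (prod_topology (top_of_set {0..1}) (top_of_set Y)) (top_of_set Y) ?h"
      using assms(4) by auto
  qed auto
qed

text \<open>A cell count: a face \<open>s\<close> contributes one open cube of dimension
  \<open>card s\<close> for every choice of signs at the other coordinates below
  \<open>n\<close>.\<close>

definition moment_angle_euler :: "nat \<Rightarrow> nat set set \<Rightarrow> int" where
  "moment_angle_euler n K = (\<Sum>s \<in> K \<inter> Pow {..<n}. (-1) ^ card s * 2 ^ (n - card s))"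

text \<open>A face without \<open>n\<close> gets one more sign to choose, which doubles its term. A
  face with \<open>n\<close> comes from a face of the link and has one more dimension, which changes
  the sign.\<close>

lemma moment_angle_euler_Suc:
  "moment_angle_euler (Suc n) K
     = 2 * moment_angle_euler n K - moment_angle_euler n {t. insert n t \<in> K}"
proof -
  let ?L = "{t. insert n t \<in> K}"
  let ?f = "\<lambda>s :: nat set. (-1 :: int) ^ card s * 2 ^ (Suc n - card s)"
  have split: "K \<inter> Pow {..<Suc n} = (K \<inter> Pow {..<n}) \<union> insert n ` (?L \<inter> Pow {..<n})"
  proof (intro equalityI subsetI)
    fix s assume s: "s \<in> K \<inter> Pow {..<Suc n}"
    show "s \<in> (K \<inter> Pow {..<n}) \<union> insert n ` (?L \<inter> Pow {..<n})"
    proof (cases "n \<in> s")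
      case True
      then have "s = insert n (s - {n})" by auto
      moreover have "s - {n} \<in> ?L \<inter> Pow {..<n}"
        using s True by (auto simp: insert_absorb less_Suc_eq)
      ultimately show ?thesis by blast
    next
      case False
      then show ?thesis using s by (auto simp: less_Suc_eq)
    qed
  qed auto
  have inj: "inj_on (insert n) (?L \<inter> Pow {..<n})"
    by (rule inj_onI) (metis Int_iff PowD insert_ident lessThan_iff less_irrefl subsetD)
  have "moment_angle_euler (Suc n) K = sum ?f (K \<inter> Pow {..<n}) + sum ?f (insert n ` (?L \<inter> Pow {..<n}))"
    unfolding moment_angle_euler_def split by (rule sum.union_disjoint) auto
  also have "sum ?f (K \<inter> Pow {..<n}) = 2 * moment_angle_euler n K"
    unfolding moment_angle_euler_def sum_distrib_left
  proof (rule sum.cong)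
    fix s assume "s \<in> K \<inter> Pow {..<n}"
    then have "card s \<le> n" using card_mono[of "{..<n}" s] by auto
    then show "?f s = 2 * ((-1) ^ card s * 2 ^ (n - card s))" by (simp add: Suc_diff_le)
  qed auto
  also have "sum ?f (insert n ` (?L \<inter> Pow {..<n})) = - moment_angle_euler n ?L"
    unfolding moment_angle_euler_def sum.reindex[OF inj] sum_negf[symmetric]
  proof (rule sum.cong)
    fix s assume s: "s \<in> ?L \<inter> Pow {..<n}"
    then have "finite s" "n \<notin> s" using finite_subset[of s "{..<n}"] by auto
    then show "(?f \<circ> insert n) s = - ((-1) ^ card s * 2 ^ (n - card s))" by simp
  qed auto
  finally show ?thesis by simp
qed

lemma convex_bounds:
  fixes t u :: real
  assumes "0 \<le> t" "t \<le> 1"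
  shows "\<bar>u\<bar> \<le> 1 \<Longrightarrow> \<bar>c\<bar> \<le> 1 \<Longrightarrow> \<bar>(1 - t) * c + t * u\<bar> \<le> 1"
    and "a < c \<Longrightarrow> a < u \<Longrightarrow> a < (1 - t) * c + t * u"
    and "c < b \<Longrightarrow> u < b \<Longrightarrow> (1 - t) * c + t * u < b"
proof -
  show "\<bar>(1 - t) * c + t * u\<bar> \<le> 1" if "\<bar>u\<bar> \<le> 1" "\<bar>c\<bar> \<le> 1"
    using assms that convex_bound_le[of c 1 u "1 - t" t] convex_bound_le[of "-c" 1 "-u" "1 - t" t]
    by (simp add: abs_le_iff)
  show "(1 - t) * c + t * u < b" if "c < b" "u < b"
    using assms that convex_bound_lt[of c b u "1 - t" t] by simp
  show "a < (1 - t) * c + t * u" if "a < c" "a < u"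
    using assms that convex_bound_lt[of "-c" "-a" "-u" "1 - t" t] by simp
qed

lemma free_coords_upd:
  "free_coords (x(n := c)) = (if \<bar>c\<bar> = 1 then free_coords x - {n} else insert n (free_coords x))"
  by (auto simp: free_coords_def)

lemma moment_angle_upd:
  assumes "down_closed K" "x \<in> moment_angle (Suc n) K" "\<bar>c\<bar> \<le> 1" "x n = c \<or> \<bar>x n\<bar> < 1"
  shows "x(n := c) \<in> moment_angle (Suc n) K"
proof -
  have "free_coords (x(n := c)) \<subseteq> free_coords x"
    using assms(4) by (auto simp: free_coords_def split: if_splits)
  then show ?thesis
    using assms down_closedD[OF assms(1)] by (auto simp: moment_angle_def)
qed

lemma moment_angle_restrict:
  assumes "down_closed K" "x \<in> moment_angle (Suc n) K"
  shows "x(n := 1) \<in> moment_angle n K"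
proof -
  have "free_coords (x(n := 1)) \<subseteq> free_coords x" by (auto simp: free_coords_def)
  then show ?thesis
    using assms down_closedD[OF assms(1)] by (auto simp: moment_angle_def)
qed

text \<open>Where coordinate \<open>n\<close> equals \<open>c\<close> the homotopy is constant.
  Elsewhere, with the wall at \<open>- c\<close> removed, the coordinate is free; moving a free
  coordinate creates no further free coordinates, so it can be slid to \<open>c\<close>.\<close>

lemma moment_angle_half_homotopy_equivalent:
  assumes K: "down_closed K" and c: "c = 1 \<or> c = -1"
  shows "top_of_set {x \<in> moment_angle (Suc n) K. x n \<noteq> - c}
     homotopy_equivalent_space top_of_set (moment_angle n K)"
proof (rule homotopy_equivalent_straighten[where n = n and c = c])
  fix x assume x: "x \<in> {x \<in> moment_angle (Suc n) K. x n \<noteq> - c}"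
  then show "x(n := 1) \<in> moment_angle n K"
    using moment_angle_restrict[OF K] by simp
  fix t :: real assume t: "t \<in> {0..1}"
  have *: "\<bar>x n\<bar> \<le> 1" using x by (auto simp: moment_angle_def)
  show "x(n := (1 - t) * c + t * x n) \<in> {x \<in> moment_angle (Suc n) K. x n \<noteq> - c}"
  proof (cases "x n = c")
    case True
    then have "(1 - t) * c + t * x n = x n" by (simp add: algebra_simps)
    then show ?thesis using x by simp
  next
    case False
    then have "\<bar>x n\<bar> < 1" using x c * by auto
    then have "- 1 < x n" "x n < 1" by auto
    moreover have "(1 - t) * c + t * x n \<noteq> - c"
      using c t \<open>- 1 < x n\<close> \<open>x n < 1\<close> convex_bounds(2)[where t = t and a = "-1" and c = 1 and u = "x n"]
        convex_bounds(3)[where t = t and b = 1 and c = "-1" and u = "x n"] by auto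
    moreover have "\<bar>(1 - t) * c + t * x n\<bar> \<le> 1"
      using convex_bounds(1)[where t = t and c = c and u = "x n"] t c * by auto
    ultimately show ?thesis
      using moment_angle_upd[OF K, of x n] x \<open>\<bar>x n\<bar> < 1\<close> by auto
  qed
next
  fix z assume z: "z \<in> moment_angle n K"
  have "free_coords (z(n := c)) \<subseteq> free_coords z" using c by (auto simp: free_coords_def)
  then show "z(n := c) \<in> {x \<in> moment_angle (Suc n) K. x n \<noteq> - c}"
    using z c down_closedD[OF K] by (auto simp: moment_angle_def)
qed (auto simp: moment_angle_def)

text \<open>Here \<open>n\<close> is always free, so the remaining free coordinates form a face of
  the link, and they do not change while coordinate \<open>n\<close> is contracted to 0.\<close>

lemma moment_angle_link_homotopy_equivalent:
  "top_of_set {x \<in> moment_angle (Suc n) K. \<bar>x n\<bar> < 1}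
     homotopy_equivalent_space top_of_set (moment_angle n {t. insert n t \<in> K})"
proof (rule homotopy_equivalent_straighten[where n = n and c = 0])
  fix x assume x: "x \<in> {x \<in> moment_angle (Suc n) K. \<bar>x n\<bar> < 1}"
  then have n: "insert n (free_coords x) = free_coords x"
    by (auto simp: free_coords_def)
  then have "insert n (free_coords (x(n := 1))) = free_coords x"
    by (auto simp: free_coords_upd)
  then show "x(n := 1) \<in> moment_angle n {t. insert n t \<in> K}"
    using x by (auto simp: moment_angle_def)
  fix t :: real assume t: "t \<in> {0..1}"
  let ?c = "(1 - t) * 0 + t * x n"
  have c: "\<bar>?c\<bar> < 1"
    using x t mult_le_one[of t "\<bar>x n\<bar>"] mult_left_le_one_le[of "\<bar>x n\<bar>" t] by (auto simp: abs_mult)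
  then have "free_coords (x(n := ?c)) = free_coords x"
    using n by (auto simp: free_coords_upd)
  then show "x(n := ?c) \<in> {x \<in> moment_angle (Suc n) K. \<bar>x n\<bar> < 1}"
    using x c by (auto simp: moment_angle_def)
next
  fix z assume "z \<in> moment_angle n {t. insert n t \<in> K}"
  then show "z(n := 0) \<in> {x \<in> moment_angle (Suc n) K. \<bar>x n\<bar> < 1}"
    by (auto simp: moment_angle_def free_coords_upd)
qed (auto simp: moment_angle_def)

theorem euler_moment_angle:
  assumes "down_closed K"
  shows "euler_pair (top_of_set (moment_angle n K)) {} (moment_angle_euler n K)"
  using assms
proof (induction n arbitrary: K)
  case 0
  \<comment> \<open>There is one point or none: a down-closed family may be empty, as is the link of
    an index that is not a vertex.\<close>
  have one: "x \<in> moment_angle 0 K \<longleftrightarrow> x = (\<lambda>_. 1) \<and> {} \<in> K" for x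
    by (auto simp: moment_angle_def free_coords_def)
  show ?case
  proof (cases "{} \<in> K")
    case True
    then have "moment_angle 0 K = {\<lambda>_. 1}" "K \<inter> Pow {..<0} = {{}}" using one by auto
    then show ?thesis
      using euler_pair_singleton[of "top_of_set (moment_angle 0 K)"] by (simp add: moment_angle_euler_def)
  next
    case False
    then have "moment_angle 0 K = {}" "K \<inter> Pow {..<0} = {}" using one by auto
    then show ?thesis
      using euler_pair_empty[of "top_of_set (moment_angle 0 K)"] by (simp add: moment_angle_euler_def)
  qed
next
  case (Suc n)
  let ?M = "moment_angle (Suc n) K" and ?L = "{t. insert n t \<in> K}"
  let ?A = "{x \<in> ?M. x n \<noteq> - 1}" and ?B = "{x \<in> ?M. x n \<noteq> - (- 1)}"
  have L: "down_closed ?L"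
    unfolding down_closed_def using down_closedD[OF Suc.prems] by (metis insert_mono mem_Collect_eq)
  have op: "openin (top_of_set ?M) {x \<in> ?M. x n \<noteq> c}" for c
  proof -
    have "open {x :: nat \<Rightarrow> real. x n \<noteq> c}"
      by (rule open_Collect_neq) (auto intro: continuous_on_coordinate)
    moreover have "{x \<in> ?M. x n \<noteq> c} = ?M \<inter> {x. x n \<noteq> c}" by auto
    ultimately show ?thesis by (auto simp: openin_open)
  qed
  have AB: "?A \<inter> ?B = {x \<in> ?M. \<bar>x n\<bar> < 1}"
  proof -
    have "x n \<noteq> - 1 \<and> x n \<noteq> - (- 1) \<longleftrightarrow> \<bar>x n\<bar> < 1" if "x \<in> ?M" for x
    proof -
      have "\<bar>x n\<bar> \<le> 1" using that by (simp add: moment_angle_def)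
      then show ?thesis by linarith
    qed
    then show ?thesis by blast
  qed
  have A: "euler_pair (top_of_set ?A) {} (moment_angle_euler n K)"
    by (rule euler_pair_homotopy_equivalent[OF homotopy_equivalent_space_sym[THEN iffD1,
          OF moment_angle_half_homotopy_equivalent[OF Suc.prems]] Suc.IH[OF Suc.prems]]) simp
  have B: "euler_pair (top_of_set ?B) {} (moment_angle_euler n K)"
    by (rule euler_pair_homotopy_equivalent[OF homotopy_equivalent_space_sym[THEN iffD1,
          OF moment_angle_half_homotopy_equivalent[OF Suc.prems]] Suc.IH[OF Suc.prems]]) simp
  have C: "euler_pair (top_of_set (?A \<inter> ?B)) {} (moment_angle_euler n ?L)"
    unfolding AB by (rule euler_pair_homotopy_equivalent[OF homotopy_equivalent_space_sym[THEN iffD1,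
          OF moment_angle_link_homotopy_equivalent] Suc.IH[OF L]])
  have sub: "subtopology (top_of_set ?M) U = top_of_set U" if "U \<subseteq> ?M" for U
    using that by (simp add: subtopology_subtopology Int_absorb1)
  have subA: "subtopology (top_of_set ?M) ?A = top_of_set ?A"
    and subB: "subtopology (top_of_set ?M) ?B = top_of_set ?B"
    and subC: "subtopology (top_of_set ?M) (?A \<inter> ?B) = top_of_set (?A \<inter> ?B)"
    by (rule sub, blast)+
  have "euler_pair (top_of_set ?M) {} (moment_angle_euler n K + moment_angle_euler n K - moment_angle_euler n ?L)"
  proof (rule euler_pair_open_cover[OF op op])
    show "?A \<union> ?B = topspace (top_of_set ?M)" by auto
  qed (unfold subA subB subC, rule A, rule B, rule C)
  then show ?case by (simp add: moment_angle_euler_Suc)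
qed

section \<open>Compactness and connectedness of moment-angle complexes\<close>

text \<open>The set is a finite union, over the faces inside \<open>{..<n}\<close>, of products of
  compact sets, so Tychonoff's theorem applies. Taking both signs for \<open>D i\<close> below
  \<open>n\<close> gives the whole complex; taking the single sign \<open>v i\<close> gives the
  closed star of a vertex.\<close>

lemma compact_cube_restricted:
  fixes D :: "nat \<Rightarrow> real set"
  assumes "down_closed K" "\<And>i. compact (D i)"
  shows "compact {x. (\<forall>i. \<bar>x i\<bar> \<le> 1) \<and> {i. x i \<notin> D i} \<in> K \<and> {i. x i \<notin> D i} \<subseteq> {..<n}}" (is "compact ?S")
proof -
  define C :: "nat set \<Rightarrow> nat \<Rightarrow> real set" where
    "C = (\<lambda>s i. if i \<in> s then {-1..1} else D i \<inter> {-1..1})"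
  have "?S = (\<Union>s \<in> K \<inter> Pow {..<n}. PiE UNIV (C s))"
  proof (intro equalityI subsetI)
    fix x assume x: "x \<in> ?S"
    then have "x i \<in> C {i. x i \<notin> D i} i" for i
      by (auto simp: C_def abs_le_iff minus_le_iff)
    then show "x \<in> (\<Union>s \<in> K \<inter> Pow {..<n}. PiE UNIV (C s))"
      using x by auto
  next
    fix x assume "x \<in> (\<Union>s \<in> K \<inter> Pow {..<n}. PiE UNIV (C s))"
    then obtain s where s: "s \<in> K" "s \<subseteq> {..<n}" and x: "\<And>i. x i \<in> C s i" by auto
    have "\<bar>x i\<bar> \<le> 1 \<and> (x i \<notin> D i \<longrightarrow> i \<in> s)" for i
      using x[of i] by (auto simp: C_def split: if_splits)
    then have *: "\<And>i. \<bar>x i\<bar> \<le> 1" "{i. x i \<notin> D i} \<subseteq> s" by auto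
    then have "{i. x i \<notin> D i} \<in> K" using down_closedD[OF assms(1) s(1)] by simp
    then show "x \<in> ?S" using * s(2) by auto
  qed
  moreover have "compact (PiE UNIV (C s))" for s
  proof -
    have "compact (C s i)" for i using assms(2) by (simp add: C_def compact_Int_closed)
    then have "compactin (product_topology (\<lambda>i. euclidean) UNIV) (PiE UNIV (C s))"
      by (subst compactin_PiE) (auto simp: compactin_euclidean_iff)
    then show ?thesis by (simp add: euclidean_product_topology compactin_euclidean_iff)
  qed
  moreover have "finite (K \<inter> Pow {..<n})" by simp
  ultimately show ?thesis by (metis (no_types, lifting) compact_UN)
qed

lemma compact_moment_angle:
  assumes "down_closed K"
  shows "compact (moment_angle n K)"
proof -
  \<comment> \<open>From \<open>n\<close> on only the value 1 is allowed, so the exceptional indices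
    lie below \<open>n\<close> exactly when the later coordinates are pinned.\<close>
  let ?D = "\<lambda>i. if i < n then {-1, 1} else {1 :: real}"
  have "moment_angle n K = {x. (\<forall>i. \<bar>x i\<bar> \<le> 1) \<and> {i. x i \<notin> ?D i} \<in> K \<and> {i. x i \<notin> ?D i} \<subseteq> {..<n}}"
  proof -
    define E where "E = (\<lambda>x :: nat \<Rightarrow> real. {i. x i \<notin> ?D i})"
    have 1: "(\<forall>i\<ge>n. x i = 1) \<longleftrightarrow> E x \<subseteq> {..<n}" for x
      by (auto simp: E_def subset_iff not_less)
    have 2: "E x = free_coords x" if "\<forall>i\<ge>n. x i = 1" for x
    proof -
      have "x i \<notin> ?D i \<longleftrightarrow> \<bar>x i\<bar> \<noteq> 1" for i
        by (cases "i < n") (use that in \<open>auto simp: abs_if\<close>)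
      then show ?thesis by (simp add: E_def free_coords_def)
    qed
    have "moment_angle n K = {x. (\<forall>i. \<bar>x i\<bar> \<le> 1) \<and> E x \<in> K \<and> E x \<subseteq> {..<n}}"
      unfolding moment_angle_def by (rule Collect_cong) (metis 1 2)
    then show ?thesis by (simp only: E_def)
  qed
  then show ?thesis using compact_cube_restricted[OF assms, of ?D n] by simp
qed

text \<open>Induction on the number of coordinates different from 1, one of which is slid to 1. If
  there is a free coordinate it is chosen, and the segment stays over the same face; otherwise the
  point is a vertex and the segment an edge, present because every \<open>{i}\<close> is a
  face.\<close>

lemma connected_moment_angle:
  assumes K: "down_closed K" "{} \<in> K" "\<And>i. i < n \<Longrightarrow> {i} \<in> K"
  shows "connected (moment_angle n K)"
proof -
  let ?S = "moment_angle n K"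
  have "connected_component ?S x (\<lambda>_. 1)" if "x \<in> ?S" for x
    using that
  proof (induction "card {i. x i \<noteq> 1}" arbitrary: x rule: less_induct)
    case (less x)
    have sub: "{i. x i \<noteq> 1} \<subseteq> {..<n}" using less.prems by (force simp: moment_angle_def not_less[symmetric])
    then have fin: "finite {i. x i \<noteq> 1}" by (rule finite_subset) simp
    show ?case
    proof (cases "{i. x i \<noteq> 1} = {}")
      case True
      then have "x = (\<lambda>_. 1)" by auto
      then show ?thesis using less.prems by (simp add: connected_component_refl)
    next
      case False
      obtain i where i: "x i \<noteq> 1" "insert i (free_coords x) \<in> K"
      proof (cases "free_coords x = {}")
        case True
        then show thesis using that False K(3) sub by auto
      next
        case False
        then obtain i where "i \<in> free_coords x" by auto
        then show thesis using that[of i] less.prems by (auto simp: moment_angle_def free_coords_def insert_absorb)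
      qed
      have in_S: "x(i := s) \<in> ?S" if "s \<in> {-1..1}" for s
      proof -
        have "free_coords (x(i := s)) \<in> K"
          using i(2) by (rule down_closedD[OF K(1)]) (auto simp: free_coords_def)
        then show ?thesis using less.prems that i sub by (auto simp: moment_angle_def)
      qed
      have "connected ((\<lambda>s. x(i := s)) ` {-1..1})"
        by (intro connected_continuous_image continuous_on_fun_upd) (auto intro: continuous_intros)
      moreover have "(\<lambda>s. x(i := s)) ` {-1..1} \<subseteq> ?S" using in_S by auto
      moreover have "x \<in> (\<lambda>s. x(i := s)) ` {-1..1}"
      proof
        show "x = x(i := x i)" by simp
        show "x i \<in> {-1..1}" using less.prems by (auto simp: moment_angle_def abs_le_iff)
      qed
      moreover have "x(i := 1) \<in> (\<lambda>s. x(i := s)) ` {-1..1}" by auto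
      ultimately have "connected_component ?S x (x(i := 1))"
        by (rule connected_component_maximal[THEN subsetD, THEN CollectD, rotated 3] connected_componentI)
      moreover have "connected_component ?S (x(i := 1)) (\<lambda>_. 1)"
      proof (rule less.hyps)
        show "card {j. (x(i := 1)) j \<noteq> 1} < card {i. x i \<noteq> 1}"
          by (rule psubset_card_mono[OF fin]) (use i in auto)
      qed (use in_S in auto)
      ultimately show ?thesis by (rule connected_component_trans)
    qed
  qed
  then show ?thesis
    unfolding connected_iff_connected_component
    by (meson connected_component_sym connected_component_trans)
qed

section \<open>The surface of a cycle\<close>

definition cycle_complex :: "nat \<Rightarrow> nat set set" where
  "cycle_complex n = {s. \<exists>k<n. s \<subseteq> {k, Suc k mod n}}"

definition cycle_surface :: "nat \<Rightarrow> (nat \<Rightarrow> real) set" where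
  "cycle_surface n = moment_angle n (cycle_complex n)"

lemma down_closed_cycle_complex: "down_closed (cycle_complex n)"
  unfolding down_closed_def cycle_complex_def by blast

lemma Suc_mod_if: "k < n \<Longrightarrow> Suc k mod n = (if Suc k = n then 0 else Suc k)"
  by auto

lemma Suc_mod_less: "k < n \<Longrightarrow> Suc k mod n < n"
  by auto

lemma Suc_mod_neq: "k < n \<Longrightarrow> n \<ge> 2 \<Longrightarrow> Suc k mod n \<noteq> k"
  by (auto simp: Suc_mod_if)

lemma Suc_mod_inj: "k < n \<Longrightarrow> l < n \<Longrightarrow> Suc k mod n = Suc l mod n \<Longrightarrow> k = l"
  by (auto simp: Suc_mod_if split: if_splits)

text \<open>This fails for n = 2, where the two edges of the cycle coincide. It makes the edges
  distinct and separates the two neighbours of a vertex.\<close>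

lemma Suc_mod_no_2_cycle: "k < n \<Longrightarrow> l < n \<Longrightarrow> n \<ge> 3 \<Longrightarrow> Suc k mod n = l \<Longrightarrow> Suc l mod n \<noteq> k"
  by (auto simp: Suc_mod_if split: if_splits)

lemma cycle_pair_inj:
  assumes "n \<ge> 3" "k < n" "l < n" "{k, Suc k mod n} = {l, Suc l mod n}"
  shows "k = l"
  using assms Suc_mod_no_2_cycle[of k n l] by (metis doubleton_eq_iff)

lemma cycle_complex_alt:
  "n \<ge> 3 \<Longrightarrow> cycle_complex n
     = {{}} \<union> (\<lambda>k. {k}) ` {..<n} \<union> (\<lambda>k. {k, Suc k mod n}) ` {..<n}"
proof (intro equalityI subsetI)
  fix s assume "n \<ge> 3" "s \<in> cycle_complex n"
  then obtain k where k: "k < n" "s \<subseteq> {k, Suc k mod n}" by (auto simp: cycle_complex_def)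
  then consider "s = {}" | "s = {k}" | "s = {Suc k mod n}" | "s = {k, Suc k mod n}" by blast
  then show "s \<in> {{}} \<union> (\<lambda>k. {k}) ` {..<n} \<union> (\<lambda>k. {k, Suc k mod n}) ` {..<n}"
    using k(1) Suc_mod_less[OF k(1)] by cases auto
next
  fix s assume "n \<ge> 3" "s \<in> {{}} \<union> (\<lambda>k. {k}) ` {..<n} \<union> (\<lambda>k. {k, Suc k mod n}) ` {..<n}"
  moreover from \<open>n \<ge> 3\<close> have "0 < n" by simp
  ultimately show "s \<in> cycle_complex n" unfolding cycle_complex_def by blast
qed

text \<open>The cycle has the empty face, n vertices and n edges, so the surface has 2^n vertices, n
  2^(n-1) edges and n 2^(n-2) squares. Their alternating sum is (4 - n) 2^(n-2).\<close>

lemma moment_angle_euler_cycle: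
  assumes "n \<ge> 3"
  shows "moment_angle_euler n (cycle_complex n) = 2 - 2 * (1 + (int n - 4) * 2 ^ (n - 3))"
proof -
  let ?f = "\<lambda>s :: nat set. (-1 :: int) ^ card s * 2 ^ (n - card s)"
  let ?V = "(\<lambda>k. {k}) ` {..<n}" and ?E = "(\<lambda>k. {k, Suc k mod n}) ` {..<n}"
  have card2: "card {k, Suc k mod n} = 2" if "k < n" for k
    using Suc_mod_neq[OF that] assms by (subst card_2_iff) auto
  have "cycle_complex n \<inter> Pow {..<n} = {{}} \<union> ?V \<union> ?E"
    using assms by (auto simp: cycle_complex_alt)
  then have "moment_angle_euler n (cycle_complex n) = sum ?f ({{}} \<union> ?V \<union> ?E)"
    by (simp add: moment_angle_euler_def)
  also have "\<dots> = sum ?f ({{}} \<union> ?V) + sum ?f ?E"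
  proof (rule sum.union_disjoint)
    show "({{}} \<union> ?V) \<inter> ?E = {}"
    proof (rule equals0I)
      fix s assume s: "s \<in> ({{}} \<union> ?V) \<inter> ?E"
      then obtain k where "k < n" "s = {k, Suc k mod n}" by blast
      then have "card s = 2" using card2 by simp
      moreover from s have "s = {} \<or> (\<exists>k. s = {k})" by blast
      ultimately show False by auto
    qed
  qed auto
  also have "sum ?f ({{}} \<union> ?V) = 2 ^ n + sum ?f ?V"
    by (subst sum.union_disjoint) auto
  also have "sum ?f ?V = - (int n * 2 ^ (n - 1))"
    by (subst sum.reindex) (auto simp: inj_on_def)
  also have "sum ?f ?E = (\<Sum>k<n. ?f {k, Suc k mod n})"
    by (subst sum.reindex) (use cycle_pair_inj[OF assms] in \<open>auto simp: inj_on_def\<close>)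
  also have "\<dots> = int n * 2 ^ (n - 2)"
    using card2 by simp
  finally have *: "moment_angle_euler n (cycle_complex n) = 2 ^ n - int n * 2 ^ (n - 1) + int n * 2 ^ (n - 2)"
    by simp
  \<comment> \<open>Writing n = m + 3 removes the truncated subtractions from the exponents.\<close>
  obtain m where "n = m + 3" using assms by (metis add.commute le_Suc_ex)
  then show ?thesis unfolding * by (simp add: algebra_simps power_add)
qed

section \<open>Orientation of plane maps\<close>

text \<open>The loop q satisfies q' = 2 pi i (q - a), so the integrand defining the winding number
  is constant on the unit interval.\<close>

lemma winding_number_affine_circlepath:
  assumes "c \<noteq> 0" "r > 0"
  shows "winding_number (\<lambda>t. a + c * (circlepath z r t - z)) a = 1"
proof -
  let ?q = "\<lambda>t. a + c * (circlepath z r t - z)"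
  have der: "(?q has_vector_derivative (2 * of_real pi * \<i> * (?q t - a))) (at t within T)" for t T
  proof -
    have "((\<lambda>w. a + c * (of_real r * exp (2 * of_real pi * \<i> * w))) has_field_derivative
        2 * of_real pi * \<i> * (c * (of_real r * exp (2 * of_real pi * \<i> * of_real t)))) (at (of_real t))"
      by (auto intro!: derivative_eq_intros)
    then show ?thesis
      using has_vector_derivative_real_field by (fastforce simp: circlepath)
  qed
  have nz: "?q t \<noteq> a" for t
    using assms by (auto simp: circlepath)
  have "valid_path ((\<lambda>w. a + c * (w - z)) \<circ> circlepath z r)"
    by (rule valid_path_compose_holomorphic[where S = UNIV]) (auto intro!: holomorphic_intros)
  then have valid: "valid_path ?q" by (simp add: o_def)
  have "((\<lambda>w. 1 / (w - a)) has_contour_integral (2 * of_real pi * \<i>)) ?q"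
    unfolding has_contour_integral_def
  proof (rule has_integral_eq)
    show "((\<lambda>t :: real. 2 * of_real pi * \<i>) has_integral (2 * of_real pi * \<i>)) {0..1}"
      using has_integral_const_real[of "2 * of_real pi * \<i>" 0 1] by simp
    fix t :: real assume "t \<in> {0..1}"
    then have "vector_derivative ?q (at t within {0..1}) = 2 * of_real pi * \<i> * (?q t - a)"
      using vector_derivative_within_cbox[of 0 1 t, OF _ _ der] by simp
    then show "2 * of_real pi * \<i> = 1 / (?q t - a) * vector_derivative ?q (at t within {0..1})"
      using nz[of t] by (simp add: field_simps)
  qed
  then have "contour_integral ?q (\<lambda>w. 1 / (w - a)) = 2 * of_real pi * \<i>"
    by (rule contour_integral_unique)
  moreover have "a \<notin> path_image ?q"
    using nz by (force simp: path_image_def)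
  ultimately show ?thesis
    using winding_number_valid_path[OF valid] by simp
qed

text \<open>If \<open>h w - h z\<close> never points opposite to \<open>c (w - z)\<close>, then the straight-line homotopy deforms
  the image of a circle around \<open>z\<close> into its image under an affine rotation, avoiding \<open>h z\<close>.\<close>

lemma orientation_preserving_onI:
  assumes "continuous_on W h" "c \<noteq> 0"
    and "\<And>z w s. z \<in> W \<Longrightarrow> w \<in> W \<Longrightarrow> 0 \<le> s \<Longrightarrow> h w - h z = - of_real s * (c * (w - z)) \<Longrightarrow> w = z"
  shows "orientation_preserving_on W h"
  unfolding orientation_preserving_on_def
proof (intro ballI allI impI)
  fix z r assume z: "z \<in> W" and r: "(0::real) < r" and sub: "cball z r \<subseteq> W"
  let ?g = "h \<circ> circlepath z r" and ?q = "\<lambda>t. h z + c * (circlepath z r t - z)"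
  have circ: "circlepath z r t \<in> W" "circlepath z r t \<noteq> z" if "t \<in> {0..1}" for t
  proof -
    have "circlepath z r t \<in> path_image (circlepath z r)" using that by (simp add: path_image_def)
    then have "circlepath z r t \<in> sphere z r" using r by simp
    then show "circlepath z r t \<in> W" "circlepath z r t \<noteq> z" using sub r by auto
  qed
  have "continuous_on {0..1} ?g"
    by (rule continuous_on_compose)
      (use circ in \<open>auto intro: continuous_on_subset[OF assms(1)] simp: path_def[symmetric]\<close>)
  then have "path ?g" by (simp add: path_def)
  moreover have "path ?q" unfolding path_def circlepath by (intro continuous_intros)
  ultimately have "homotopic_loops (- {h z}) ?g ?q"
  proof (rule homotopic_loops_linear)
    show "pathfinish ?g = pathstart ?g" "pathfinish ?q = pathstart ?q"
      using pathfinish_circlepath[of z r] pathstart_circlepath[of z r]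
      by (simp_all add: pathfinish_def pathstart_def)
    fix t :: real assume t: "t \<in> {0..1}"
    let ?w = "circlepath z r t"
    have "h z \<notin> closed_segment (?g t) (?q t)"
    proof
      assume "h z \<in> closed_segment (?g t) (?q t)"
      then obtain u where u: "0 \<le> u" "u \<le> 1" "h z = (1 - u) *\<^sub>R ?g t + u *\<^sub>R ?q t"
        by (auto simp: closed_segment_def)
      \<comment> \<open>For u = 1 this forces the point of the circle to be its centre, as
        \<open>c\<close> is nonzero. Otherwise division by 1 - u yields the excluded relation with s
        = u / (1 - u).\<close>
      have eq: "of_real (1 - u) * (h ?w - h z) = - of_real u * (c * (?w - z))"
        using u(3) by (simp add: scaleR_conv_of_real algebra_simps)
      show False
      proof (cases "u = 1")
        case True
        then show False using eq assms(2) circ(2)[OF t] by simp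
      next
        case False
        then have "complex_of_real (1 - u) \<noteq> 0" by (metis eq_iff_diff_eq_0 of_real_eq_0_iff)
        then have "h ?w - h z = - of_real u * (c * (?w - z)) / of_real (1 - u)"
          using eq by (metis nonzero_mult_div_cancel_left)
        then have "h ?w - h z = - of_real (u / (1 - u)) * (c * (?w - z))"
          by (simp only: of_real_divide) simp
        then show False
          using assms(3)[OF z circ(1)[OF t], of "u / (1 - u)"] u circ(2)[OF t] by auto
      qed
    qed
    then show "closed_segment (?g t) (?q t) \<subseteq> - {h z}" by auto
  qed
  then have "winding_number ?g (h z) = winding_number ?q (h z)"
    by (rule winding_number_homotopic_loops)
  then show "winding_number ?g (h z) = 1"
    using winding_number_affine_circlepath[OF assms(2) r] by simp
qed

section \<open>Sectors of a regular polygon\<close>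

locale polygon_sectors =
  fixes n :: nat
  assumes n_ge_3: "n \<ge> 3"
begin

definition \<theta> :: real where "\<theta> = 2 * pi / n"

definition \<omega> :: complex where "\<omega> = cis \<theta>"

text \<open>The cone over the n-cycle, which models the surface near a vertex of the cube.
  \<open>fan_map\<close> sends its i-th generator to an n-th root of unity and is linear on each
  two-dimensional piece.\<close>

definition cone :: "(nat \<Rightarrow> real) set" where
  "cone = {y. (\<forall>i. 0 \<le> y i) \<and> (\<forall>i\<ge>n. y i = 0) \<and> {i. y i \<noteq> 0} \<in> cycle_complex n}"

definition fan_map :: "(nat \<Rightarrow> real) \<Rightarrow> complex" where
  "fan_map y = (\<Sum>i<n. of_real (y i) * \<omega> ^ i)"

lemma theta_bounds: "0 < \<theta>" "\<theta> < pi"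
  using n_ge_3 by (auto simp: \<theta>_def field_simps)

lemma sin_theta_pos: "0 < sin \<theta>"
  using theta_bounds by (rule sin_gt_zero)

lemma omega_power: "\<omega> ^ k = cis (real k * \<theta>)"
  unfolding \<omega>_def by (rule Complex.DeMoivre)

lemma omega_power_n: "\<omega> ^ n = 1"
proof -
  have "real n * \<theta> = 2 * pi" using n_ge_3 by (simp add: \<theta>_def)
  then show ?thesis by (simp only: omega_power cis_2pi)
qed

lemma omega_nonzero [simp]: "\<omega> \<noteq> 0"
  by (simp add: \<omega>_def)

lemma omega_Suc_mod: "k < n \<Longrightarrow> \<omega> ^ (Suc k mod n) = \<omega> ^ k * \<omega>"
  using omega_power_n by (auto simp: Suc_mod_if simp flip: power_Suc2)

lemma Re_omega [simp]: "Re \<omega> = cos \<theta>" and Im_omega [simp]: "Im \<omega> = sin \<theta>"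
  by (simp_all add: \<omega>_def)

lemma omega_cnj: "\<omega> * cnj \<omega> = 1" "cnj \<omega> * \<omega> = 1" "\<omega> ^ k * cnj \<omega> ^ k = 1" "cnj \<omega> ^ k * \<omega> ^ k = 1"
  by (simp_all add: \<omega>_def cis_cnj cis_mult flip: power_mult_distrib)

definition sector_point :: "nat \<Rightarrow> real \<Rightarrow> real \<Rightarrow> complex" where
  "sector_point k a b = \<omega> ^ k * (of_real a + of_real b * \<omega>)"

lemma sector_coefficients_unique:
  assumes "of_real a + of_real b * \<omega> = of_real a' + of_real b' * \<omega>"
  shows "a = a'" "b = b'"
proof -
  have "b * sin \<theta> = b' * sin \<theta>"
    using arg_cong[OF assms, of Im] by simp
  then show "b = b'" using sin_theta_pos by simp
  then show "a = a'" using assms by simp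
qed

text \<open>Let rho be the argument. Then |z| sin rho = b sin \<open>\<theta>\<close> is
  nonnegative, which gives rho \<le> pi, and |z| sin (rho - \<open>\<theta>\<close>) = - a sin
  \<open>\<theta>\<close> is negative, which excludes the range from \<open>\<theta>\<close> to
  pi.\<close>

lemma Arg2pi_sector:
  assumes "0 < a" "0 \<le> b"
  shows "Arg2pi (of_real a + of_real b * \<omega>) < \<theta>"
proof -
  let ?z = "of_real a + of_real b * \<omega>"
  define \<rho> where "\<rho> = Arg2pi ?z"
  have \<rho>: "0 \<le> \<rho>" "\<rho> < 2 * pi" using Arg2pi[of ?z] by (auto simp: \<rho>_def)
  have nz: "?z \<noteq> 0"
    using sector_coefficients_unique(1)[of a b 0 0] assms by auto
  have polar: "cmod ?z * cos \<rho> = a + b * cos \<theta>" "cmod ?z * sin \<rho> = b * sin \<theta>"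
    using cos_Arg2pi[of ?z] sin_Arg2pi[of ?z] by (simp_all add: \<rho>_def)
  have "cmod ?z * sin (\<rho> - \<theta>) = (cmod ?z * sin \<rho>) * cos \<theta> - (cmod ?z * cos \<rho>) * sin \<theta>"
    by (simp add: sin_diff algebra_simps)
  also have "\<dots> = - (a * sin \<theta>)" unfolding polar by (simp add: algebra_simps)
  finally have neg: "cmod ?z * sin (\<rho> - \<theta>) = - (a * sin \<theta>)" .
  have "a * sin \<theta> > 0" using assms sin_theta_pos by simp
  then have "cmod ?z * sin (\<rho> - \<theta>) < 0" using neg by simp
  then have s1: "sin (\<rho> - \<theta>) < 0" by (simp add: mult_less_0_iff)
  have "0 \<le> cmod ?z * sin \<rho>" using polar(2) assms sin_theta_pos by simp
  then have s2: "0 \<le> sin \<rho>" using nz by (simp add: zero_le_mult_iff)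
  show ?thesis
  proof (rule ccontr)
    assume "\<not> ?thesis"
    then have "\<theta> \<le> \<rho>" by (simp add: \<rho>_def)
    moreover have "\<rho> \<le> pi"
    proof (rule ccontr)
      assume "\<not> \<rho> \<le> pi"
      then have "sin \<rho> < 0" using \<rho> by (intro sin_lt_zero) auto
      then show False using s2 by simp
    qed
    ultimately have "0 \<le> sin (\<rho> - \<theta>)" using theta_bounds by (intro sin_ge_zero) auto
    then show False using s1 by simp
  qed
qed

lemma Arg2pi_sector_point:
  assumes "k < n" "0 < a" "0 \<le> b"
  shows "real k * \<theta> \<le> Arg2pi (sector_point k a b)" "Arg2pi (sector_point k a b) < real (Suc k) * \<theta>"
    and "sector_point k a b \<noteq> 0"
proof -
  let ?z = "of_real a + of_real b * \<omega>"
  define \<rho> where "\<rho> = Arg2pi ?z"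
  have \<rho>: "0 \<le> \<rho>" "\<rho> < \<theta>" using Arg2pi[of ?z] Arg2pi_sector[OF assms(2,3)] by (auto simp: \<rho>_def)
  have nz: "?z \<noteq> 0"
    using sector_coefficients_unique(1)[of a b 0 0] assms by auto
  then show "sector_point k a b \<noteq> 0" by (simp add: sector_point_def)
  \<comment> \<open>Rotation into the k-th sector adds k \<open>\<theta>\<close> to the argument; by
    this bound the sum does not wrap around 2 pi.\<close>
  have "real (Suc k) * \<theta> \<le> real n * \<theta>"
    using assms theta_bounds by (intro mult_right_mono) auto
  also have "real n * \<theta> = 2 * pi" using n_ge_3 by (simp add: \<theta>_def)
  finally have le: "real (Suc k) * \<theta> \<le> 2 * pi" .
  have "?z = of_real (cmod ?z) * cis \<rho>"
    using Arg2pi_eq[of ?z] by (simp add: \<rho>_def cis_conv_exp)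
  then have "sector_point k a b = of_real (cmod ?z) * (cis (real k * \<theta>) * cis \<rho>)"
    by (metis sector_point_def omega_power mult.left_commute)
  then have "sector_point k a b = of_real (cmod ?z) * exp (\<i> * of_real (real k * \<theta> + \<rho>))"
    by (simp only: cis_mult) (simp only: cis_conv_exp)
  then have "Arg2pi (sector_point k a b) = real k * \<theta> + \<rho>"
    using nz \<rho> le theta_bounds by (intro Arg2pi_unique[of "cmod ?z"]) (auto simp: algebra_simps)
  then show "real k * \<theta> \<le> Arg2pi (sector_point k a b)" "Arg2pi (sector_point k a b) < real (Suc k) * \<theta>"
    using \<rho> by (auto simp: algebra_simps)
qed

text \<open>The conditions 0 < a and 0 \<le> b make the sectors half-open: each contains its first
  spoke but not its second. Their argument ranges are therefore disjoint, and within one sector the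
  two spokes are linearly independent.\<close>

lemma sector_point_unique:
  assumes "k < n" "0 < a" "0 \<le> b" "l < n" "0 < a'" "0 \<le> b'" "sector_point k a b = sector_point l a' b'"
  shows "k = l" "a = a'" "b = b'"
proof -
  have "real k * \<theta> < real (Suc l) * \<theta>" "real l * \<theta> < real (Suc k) * \<theta>"
    using Arg2pi_sector_point[OF assms(1-3)] Arg2pi_sector_point[OF assms(4-6)] assms(7) by auto
  then have "real k < real (Suc l)" "real l < real (Suc k)"
    using theta_bounds by (simp_all only: mult_less_cancel_right_pos)
  then show kl: "k = l" by simp
  then have "of_real a + of_real b * \<omega> = of_real a' + of_real b' * \<omega>"
    using assms(7) by (simp add: sector_point_def)
  then show "a = a'" "b = b'" by (rule sector_coefficients_unique)+
qed

lemma sector_point_exists: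
  assumes "z \<noteq> 0"
  obtains k a b where "k < n" "0 < a" "0 \<le> b" "z = sector_point k a b"
proof -
  let ?\<alpha> = "Arg2pi z"
  define k where "k = nat \<lfloor>?\<alpha> / \<theta>\<rfloor>"
  have \<alpha>: "0 \<le> ?\<alpha>" "?\<alpha> < 2 * pi" using Arg2pi[of z] by auto
  have k: "real k \<le> ?\<alpha> / \<theta>" "?\<alpha> / \<theta> < real k + 1"
    using \<alpha> theta_bounds by (auto simp: k_def)
  have "?\<alpha> / \<theta> < real n"
    using \<alpha> theta_bounds n_ge_3 by (simp add: \<theta>_def field_simps)
  then have "k < n" using k by simp
  define \<rho> where "\<rho> = ?\<alpha> - real k * \<theta>"
  have \<rho>: "0 \<le> \<rho>" "\<rho> < \<theta>" using k theta_bounds by (auto simp: \<rho>_def field_simps)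
  \<comment> \<open>The law of sines, for the triangle with the sides a, b \<open>\<omega>\<close>
    and their sum at angle \<open>\<rho>\<close> to the first spoke.\<close>
  define a where "a = cmod z * sin (\<theta> - \<rho>) / sin \<theta>"
  define b where "b = cmod z * sin \<rho> / sin \<theta>"
  have "0 < sin (\<theta> - \<rho>)" using \<rho> theta_bounds by (intro sin_gt_zero) auto
  then have "0 < a" using assms sin_theta_pos by (simp add: a_def)
  have "0 \<le> sin \<rho>" using \<rho> theta_bounds by (intro sin_ge_zero) auto
  then have "0 \<le> b" using sin_theta_pos by (simp add: b_def)
  have "a + b * cos \<theta> = cmod z * cos \<rho>"
    using sin_theta_pos by (simp add: a_def b_def sin_diff field_simps)
  moreover have "b * sin \<theta> = cmod z * sin \<rho>"
    using sin_theta_pos by (simp add: b_def)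
  ultimately have "of_real a + of_real b * \<omega> = of_real (cmod z) * cis \<rho>"
    by (simp add: complex_eq_iff)
  then have "sector_point k a b = of_real (cmod z) * (cis (real k * \<theta>) * cis \<rho>)"
    by (simp add: sector_point_def omega_power mult.left_commute)
  also have "\<dots> = of_real (cmod z) * exp (\<i> * of_real ?\<alpha>)"
    by (simp only: cis_mult) (simp add: cis_conv_exp \<rho>_def)
  also have "\<dots> = z" using Arg2pi_eq[of z] by simp
  finally show thesis using that \<open>k < n\<close> \<open>0 < a\<close> \<open>0 \<le> b\<close> by metis
qed

definition sector_vector :: "nat \<Rightarrow> real \<Rightarrow> real \<Rightarrow> nat \<Rightarrow> real" where
  "sector_vector k a b = (\<lambda>i. if i = k then a else if i = Suc k mod n then b else 0)"

lemma sector_vector_cone: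
  assumes "k < n" "0 \<le> a" "0 \<le> b"
  shows "sector_vector k a b \<in> cone"
proof -
  have "sector_vector k a b i = 0" if "n \<le> i" for i
  proof -
    have "i \<noteq> k" "i \<noteq> Suc k mod n" using assms(1) that Suc_mod_less[OF assms(1)] by linarith+
    then show ?thesis by (simp add: sector_vector_def)
  qed
  moreover have "{i. sector_vector k a b i \<noteq> 0} \<in> cycle_complex n"
    using assms(1) by (auto simp: sector_vector_def cycle_complex_def)
  ultimately show ?thesis
    using assms by (simp add: cone_def sector_vector_def)
qed

lemma fan_map_sector_vector: "k < n \<Longrightarrow> fan_map (sector_vector k a b) = sector_point k a b"
proof -
  assume k: "k < n"
  have neq: "Suc k mod n \<noteq> k" using Suc_mod_neq[OF k] n_ge_3 by simp
  have "fan_map (sector_vector k a b) = (\<Sum>i\<in>{k, Suc k mod n}. of_real (sector_vector k a b i) * \<omega> ^ i)"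
    unfolding fan_map_def
    by (rule sum.mono_neutral_right) (use k Suc_mod_less[OF k] in \<open>auto simp: sector_vector_def\<close>)
  then show ?thesis
    using neq by (simp add: sector_vector_def sector_point_def omega_Suc_mod[OF k] algebra_simps)
qed

text \<open>The cases match the half-open sectors, so that \<open>fan_map\<close> is bijective as
  soon as every nonzero point of the plane lies in exactly one sector.\<close>

lemma cone_cases:
  assumes "y \<in> cone"
  obtains "y = (\<lambda>_. 0)" | k a b where "k < n" "0 < a" "0 \<le> b" "y = sector_vector k a b"
proof (cases "y = (\<lambda>_. 0)")
  case False
  obtain k where k: "k < n" "{i. y i \<noteq> 0} \<subseteq> {k, Suc k mod n}"
    using assms by (auto simp: cone_def cycle_complex_def)
  have pos: "0 \<le> y i" for i using assms by (auto simp: cone_def)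
  have neq: "Suc l mod n \<noteq> l" if "l < n" for l using Suc_mod_neq[OF that] n_ge_3 by simp
  show thesis
  proof (cases "y k = 0")
    case False
    have "y = sector_vector k (y k) (y (Suc k mod n))"
    proof
      fix i show "y i = sector_vector k (y k) (y (Suc k mod n)) i"
        using k(2) by (auto simp: sector_vector_def)
    qed
    moreover have "0 < y k" using pos[of k] False by linarith
    ultimately show thesis using that(2)[OF k(1), of "y k" "y (Suc k mod n)"] pos by simp
  next
    case True
    \<comment> \<open>A vector on the second spoke of sector k is counted as lying on the first
      spoke of the next sector.\<close>
    let ?l = "Suc k mod n"
    have l: "?l < n" using k(1) by (rule Suc_mod_less)
    have supp: "y i = 0" if "i \<noteq> ?l" for i using k(2) True that by auto
    have eq: "y = sector_vector ?l (y ?l) 0"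
    proof
      fix i show "y i = sector_vector ?l (y ?l) 0 i"
        using supp by (simp add: sector_vector_def)
    qed
    have "y ?l \<noteq> 0"
    proof
      assume "y ?l = 0"
      then have "y i = 0" for i using supp[of i] by (cases "i = ?l") auto
      then show False using \<open>y \<noteq> (\<lambda>_. 0)\<close> by auto
    qed
    then have "0 < y ?l" using pos[of ?l] by linarith
    then show thesis using that(2)[OF l _ _ eq] by simp
  qed
qed (use that in auto)

lemma fan_map_0: "fan_map (\<lambda>_. 0) = 0"
  by (simp add: fan_map_def)

lemma fan_map_inj: "inj_on fan_map cone"
proof (rule inj_onI)
  fix y y' assume y: "y \<in> cone" "y' \<in> cone" "fan_map y = fan_map y'"
  show "y = y'"
    using y(1)
  proof (cases rule: cone_cases)
    case 1
    note y1 = this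
    from y(2) show ?thesis
    proof (cases rule: cone_cases)
      case (2 k a b)
      then show ?thesis
        using Arg2pi_sector_point(3)[of k a b] y(3) y1 by (simp add: fan_map_0 fan_map_sector_vector)
    qed (use y1 in simp)
  next
    case (2 k a b)
    note y2 = this
    from y(2) show ?thesis
    proof (cases rule: cone_cases)
      case 1
      then show ?thesis
        using Arg2pi_sector_point(3)[of k a b] y(3) y2 by (auto simp: fan_map_0 fan_map_sector_vector)
    next
      case (2 l a' b')
      then show ?thesis
        using sector_point_unique[of k a b l a' b'] y(3) y2 by (simp add: fan_map_sector_vector)
    qed
  qed
qed

lemma fan_map_surj: "fan_map ` cone = UNIV"
proof -
  have "z \<in> fan_map ` cone" for z
  proof (cases "z = 0")
    case True
    have "sector_vector 0 0 0 \<in> cone" by (rule sector_vector_cone) (use n_ge_3 in auto)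
    moreover have "sector_vector 0 0 0 = (\<lambda>_. 0)" by (auto simp: sector_vector_def)
    ultimately show ?thesis using True fan_map_0 by (metis image_eqI)
  next
    case False
    then obtain k a b where "k < n" "0 < a" "0 \<le> b" "z = sector_point k a b"
      by (rule sector_point_exists)
    then show ?thesis
      using sector_vector_cone[of k a b] fan_map_sector_vector[of k a b] by (metis image_eqI less_imp_le)
  qed
  then show ?thesis by auto
qed

text \<open>The coefficients along the two spokes are continuous functions \<open>f\<close> and
  \<open>g\<close> on the whole plane, so the set is cut out by weak inequalities between continuous
  functions.\<close>

lemma closed_far_sector:
  "closed {sector_point k a b | a b. 0 \<le> a \<and> 0 \<le> b \<and> (2 \<le> a \<or> 2 \<le> b)}"
proof -
  let ?u = "\<lambda>z. z * cnj \<omega> ^ k"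
  have rot: "z = sector_point k a b \<longleftrightarrow> ?u z = of_real a + of_real b * \<omega>" for z a b
  proof
    assume "?u z = of_real a + of_real b * \<omega>"
    then have "z * (cnj \<omega> ^ k * \<omega> ^ k) = sector_point k a b" by (simp add: sector_point_def mult_ac)
    then show "z = sector_point k a b" by (simp add: omega_cnj)
  next
    assume "z = sector_point k a b"
    then have "?u z = (\<omega> ^ k * cnj \<omega> ^ k) * (of_real a + of_real b * \<omega>)" by (simp add: sector_point_def mult_ac)
    then show "?u z = of_real a + of_real b * \<omega>" by (simp add: omega_cnj)
  qed
  have coeff: "u = of_real a + of_real b * \<omega> \<longleftrightarrow> b = Im u / sin \<theta> \<and> a = Re u - Im u / sin \<theta> * cos \<theta>" for u a b
  proof -
    have "u = of_real a + of_real b * \<omega> \<longleftrightarrow> b * sin \<theta> = Im u \<and> a + b * cos \<theta> = Re u"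
      by (auto simp: complex_eq_iff)
    also have "b * sin \<theta> = Im u \<longleftrightarrow> b = Im u / sin \<theta>"
      using sin_theta_pos by (auto simp: field_simps)
    finally show ?thesis by (metis add_diff_cancel_right' diff_add_cancel)
  qed
  define f where "f = (\<lambda>z. Re (?u z) - Im (?u z) / sin \<theta> * cos \<theta>)"
  define g where "g = (\<lambda>z. Im (?u z) / sin \<theta>)"
  have fg: "z = sector_point k a b \<longleftrightarrow> a = f z \<and> b = g z" for z a b
    unfolding rot coeff f_def g_def by blast
  have "{sector_point k a b | a b. 0 \<le> a \<and> 0 \<le> b \<and> (2 \<le> a \<or> 2 \<le> b)}
      = {z. 0 \<le> f z} \<inter> {z. 0 \<le> g z} \<inter> ({z. 2 \<le> f z} \<union> {z. 2 \<le> g z})"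
    by (simp only: fg) blast
  also have "closed \<dots>"
    unfolding f_def g_def
    by (intro closed_Int closed_Un closed_Collect_le continuous_intros) (use sin_theta_pos in auto)
  finally show ?thesis .
qed

text \<open>As \<open>fan_map\<close> is a bijection from the cone onto the plane, the complement is
  the image of the vectors with an entry at least 2, a finite union of closed sets. The bound 2 is
  the weight of the opposite end of an edge of the cube.\<close>

lemma open_fan_map_star: "open (fan_map ` {y \<in> cone. \<forall>i. y i < 2})"
proof -
  let ?far = "\<lambda>k. {sector_point k a b | a b. 0 \<le> a \<and> 0 \<le> b \<and> (2 \<le> a \<or> 2 \<le> b)}"
  have "fan_map ` (cone - {y \<in> cone. \<forall>i. y i < 2}) = fan_map ` cone - fan_map ` {y \<in> cone. \<forall>i. y i < 2}"
    by (rule inj_on_image_set_diff[OF fan_map_inj]) auto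
  moreover have "cone - {y \<in> cone. \<forall>i. y i < 2} = {y \<in> cone. \<not> (\<forall>i. y i < 2)}" by auto
  ultimately have "- fan_map ` {y \<in> cone. \<forall>i. y i < 2} = fan_map ` {y \<in> cone. \<not> (\<forall>i. y i < 2)}"
    by (simp add: fan_map_surj Compl_eq_Diff_UNIV)
  also have "\<dots> = (\<Union>k<n. ?far k)"
  proof (intro equalityI subsetI)
    fix z assume "z \<in> fan_map ` {y \<in> cone. \<not> (\<forall>i. y i < 2)}"
    then obtain y i where y: "y \<in> cone" "2 \<le> y i" "z = fan_map y" by (auto simp: not_less)
    from y(1) show "z \<in> (\<Union>k<n. ?far k)"
    proof (cases rule: cone_cases)
      case 1
      then show ?thesis using y(2) by simp
    next
      case (2 k a b)
      then have "2 \<le> a \<or> 2 \<le> b" using y(2) by (auto simp: sector_vector_def split: if_splits)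
      moreover have "z = sector_point k a b" "0 \<le> a" using 2 y(3) by (simp_all add: fan_map_sector_vector)
      ultimately have "z \<in> ?far k" using 2(3) by blast
      then show ?thesis using 2 by blast
    qed
  next
    fix z assume "z \<in> (\<Union>k<n. ?far k)"
    then obtain k a b where k: "k < n" "0 \<le> a" "0 \<le> b" "2 \<le> a \<or> 2 \<le> b" "z = sector_point k a b"
      by blast
    have "Suc k mod n \<noteq> k" using Suc_mod_neq[OF k(1)] n_ge_3 by simp
    then have "\<not> (\<forall>i. sector_vector k a b i < 2)"
      using k(4) by (auto simp: sector_vector_def not_less intro: exI[of _ k] exI[of _ "Suc k mod n"])
    then have "sector_vector k a b \<in> {y \<in> cone. \<not> (\<forall>i. y i < 2)}"
      using sector_vector_cone[OF k(1-3)] by simp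
    then have "fan_map (sector_vector k a b) \<in> fan_map ` {y \<in> cone. \<not> (\<forall>i. y i < 2)}"
      by (rule imageI)
    then show "z \<in> fan_map ` {y \<in> cone. \<not> (\<forall>i. y i < 2)}"
      using fan_map_sector_vector[OF k(1)] k(5) by simp
  qed
  also have "closed \<dots>" by (rule closed_UN) (simp, rule ballI, rule closed_far_sector)
  finally show ?thesis by (simp add: open_closed)
qed

end

section \<open>Charts around the vertices of the cube\<close>

definition cube_vertices :: "nat \<Rightarrow> (nat \<Rightarrow> real) set" where
  "cube_vertices n = {v. (\<forall>i. \<bar>v i\<bar> = 1) \<and> (\<forall>i\<ge>n. v i = 1)}"

lemma cube_vertex_cases: "v \<in> cube_vertices n \<Longrightarrow> v i = 1 \<or> v i = -1"
  unfolding cube_vertices_def by (metis (mono_tags, lifting) abs_eq_iff' mem_Collect_eq)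

lemma cube_vertex_square: "v \<in> cube_vertices n \<Longrightarrow> v i * v i = 1"
  using cube_vertex_cases[of v n i] by auto

lemma cube_vertex_prod_cases: "v \<in> cube_vertices n \<Longrightarrow> (\<Prod>i\<in>A. v i) = 1 \<or> (\<Prod>i\<in>A. v i) = -1"
proof (induction A rule: infinite_finite_induct)
  case (insert a A)
  then show ?case using cube_vertex_cases[OF insert.prems, of a] by auto
qed auto

lemma closed_star_eq:
  assumes "v \<in> cube_vertices n" "down_closed K"
  shows "{x \<in> moment_angle n K. {i. x i \<noteq> v i} \<in> K} =
     {x. (\<forall>i. \<bar>x i\<bar> \<le> 1) \<and> (\<forall>i\<ge>n. x i = 1) \<and> {i. x i \<noteq> v i} \<in> K}"
proof -
  have "free_coords x \<subseteq> {i. x i \<noteq> v i}" for x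
    using assms(1) by (auto simp: free_coords_def cube_vertices_def)
  then show ?thesis
    using down_closedD[OF assms(2)] by (fastforce simp: moment_angle_def)
qed

context polygon_sectors
begin

text \<open>The distance from \<open>v\<close> in each coordinate, between 0 at \<open>v\<close> and
  2 at the opposite sign. Multiplication by \<open>v i\<close> brings the stars of all vertices to
  the same model.\<close>

definition weights :: "(nat \<Rightarrow> real) \<Rightarrow> (nat \<Rightarrow> real) \<Rightarrow> nat \<Rightarrow> real" where
  "weights v x = (\<lambda>i. 1 - v i * x i)"

definition reflect :: "(nat \<Rightarrow> real) \<Rightarrow> complex \<Rightarrow> complex" where
  "reflect v z = (if (\<Prod>i<n. v i) = 1 then z else cnj z)"

definition chart :: "(nat \<Rightarrow> real) \<Rightarrow> (nat \<Rightarrow> real) \<Rightarrow> complex" where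
  "chart v x = reflect v (fan_map (weights v x))"

definition open_star :: "(nat \<Rightarrow> real) \<Rightarrow> (nat \<Rightarrow> real) set" where
  "open_star v = {x \<in> cycle_surface n. \<forall>i. x i \<noteq> - v i}"

definition closed_star :: "(nat \<Rightarrow> real) \<Rightarrow> (nat \<Rightarrow> real) set" where
  "closed_star v = {x \<in> cycle_surface n. {i. x i \<noteq> v i} \<in> cycle_complex n}"

lemma weights_eq_0_iff: "v \<in> cube_vertices n \<Longrightarrow> weights v x i = 0 \<longleftrightarrow> x i = v i"
  using cube_vertex_cases[of v n i] by (auto simp: weights_def)

lemma weights_involution:
  "v \<in> cube_vertices n \<Longrightarrow> x = (\<lambda>i. v i * (1 - weights v x i))"
  using cube_vertex_square[of v n] by (simp add: weights_def fun_eq_iff flip: mult.assoc)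

lemma weights_cone:
  assumes "v \<in> cube_vertices n" "x \<in> closed_star v"
  shows "weights v x \<in> cone"
proof -
  have "0 \<le> weights v x i" for i
  proof -
    have "\<bar>x i\<bar> \<le> 1" using assms(2) by (simp add: closed_star_def cycle_surface_def moment_angle_def)
    then show ?thesis using cube_vertex_cases[OF assms(1), of i] by (auto simp: weights_def)
  qed
  moreover have "weights v x i = 0" if "i \<ge> n" for i
    using assms that by (auto simp: weights_def closed_star_def cycle_surface_def moment_angle_def cube_vertices_def)
  moreover have "{i. weights v x i \<noteq> 0} \<in> cycle_complex n"
    using assms by (simp add: weights_eq_0_iff closed_star_def)
  ultimately show ?thesis by (simp add: cone_def)
qed

lemma weights_inj: "v \<in> cube_vertices n \<Longrightarrow> weights v x = weights v x' \<Longrightarrow> x = x'"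
  using weights_involution by metis

lemma open_star_subset:
  assumes "v \<in> cube_vertices n"
  shows "open_star v \<subseteq> closed_star v"
proof
  fix x assume x: "x \<in> open_star v"
  have "{i. x i \<noteq> v i} \<subseteq> free_coords x"
  proof
    fix i assume "i \<in> {i. x i \<noteq> v i}"
    moreover have "x i \<noteq> - v i" using x by (simp add: open_star_def)
    ultimately show "i \<in> free_coords x"
      using cube_vertex_cases[OF assms, of i] by (auto simp: free_coords_def abs_if split: if_splits)
  qed
  then show "x \<in> closed_star v"
    using x down_closedD[OF down_closed_cycle_complex]
    by (auto simp: open_star_def closed_star_def cycle_surface_def moment_angle_def)
qed

lemma weights_open_star:
  assumes "v \<in> cube_vertices n"
  shows "weights v ` open_star v = {y \<in> cone. \<forall>i. y i < 2}"
proof (intro equalityI subsetI)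
  fix y assume "y \<in> weights v ` open_star v"
  then obtain x where x: "x \<in> open_star v" "y = weights v x" by blast
  have "weights v x i < 2" for i
  proof -
    have "x i \<noteq> - v i" "\<bar>x i\<bar> \<le> 1"
      using x(1) by (simp_all add: open_star_def cycle_surface_def moment_angle_def)
    then show ?thesis using cube_vertex_cases[OF assms, of i] by (auto simp: weights_def)
  qed
  then show "y \<in> {y \<in> cone. \<forall>i. y i < 2}"
    using x weights_cone[OF assms] open_star_subset[OF assms] by auto
next
  fix y assume "y \<in> {y \<in> cone. \<forall>i. y i < 2}"
  then have y: "y \<in> cone" "\<And>i. y i < 2" by auto
  \<comment> \<open>The inverse of \<open>weights v\<close>, as each \<open>v i\<close> is its own
    inverse; the bound \<open>y i < 2\<close> keeps \<open>x i\<close> away from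
    \<open>- v i\<close>.\<close>
  define x where "x = (\<lambda>i. v i * (1 - y i))"
  have w: "weights v x = y"
    using cube_vertex_square[OF assms] by (auto simp: weights_def x_def fun_eq_iff simp flip: mult.assoc)
  have xi: "\<bar>x i\<bar> \<le> 1 \<and> x i \<noteq> - v i \<and> (i \<ge> n \<longrightarrow> x i = 1)" for i
  proof -
    have "0 \<le> y i" "y i < 2" "i \<ge> n \<longrightarrow> y i = 0" using y by (auto simp: cone_def)
    then show ?thesis
      using cube_vertex_cases[OF assms, of i] assms by (auto simp: x_def cube_vertices_def)
  qed
  have "{i. x i \<noteq> v i} = {i. y i \<noteq> 0}"
    using weights_eq_0_iff[OF assms, of x] w by auto
  then have "{i. x i \<noteq> v i} \<in> cycle_complex n" using y(1) by (simp add: cone_def)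
  then have "x \<in> cycle_surface n"
    unfolding cycle_surface_def
    using closed_star_eq[OF assms down_closed_cycle_complex[of n]] xi by blast
  then have "x \<in> open_star v" using xi by (simp add: open_star_def)
  then show "y \<in> weights v ` open_star v" using w by blast
qed

lemma compact_closed_star:
  assumes "v \<in> cube_vertices n"
  shows "compact (closed_star v)"
proof -
  have "closed_star v = {x. (\<forall>i. \<bar>x i\<bar> \<le> 1) \<and> {i. x i \<notin> {v i}} \<in> cycle_complex n \<and> {i. x i \<notin> {v i}} \<subseteq> {..<n}}"
  proof -
    have "(\<forall>i\<ge>n. x i = 1) \<longleftrightarrow> {i. x i \<notin> {v i}} \<subseteq> {..<n}" for x
      using assms by (auto simp: subset_iff cube_vertices_def) (metis not_le)+
    then show ?thesis
      unfolding closed_star_def cycle_surface_def closed_star_eq[OF assms down_closed_cycle_complex] by auto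
  qed
  then show ?thesis using compact_cube_restricted[OF down_closed_cycle_complex, of "\<lambda>i. {v i}" n] by simp
qed

lemma continuous_on_chart: "continuous_on S (chart v)"
proof -
  have "continuous_on S (\<lambda>x. fan_map (weights v x))"
    unfolding fan_map_def weights_def by (intro continuous_intros continuous_on_coordinate)
  then show ?thesis
    unfolding chart_def reflect_def by (cases "(\<Prod>i<n. v i) = 1") (auto intro: continuous_intros)
qed

lemma inj_on_chart:
  assumes "v \<in> cube_vertices n"
  shows "inj_on (chart v) (closed_star v)"
proof (rule inj_onI)
  fix x x' assume x: "x \<in> closed_star v" "x' \<in> closed_star v" "chart v x = chart v x'"
  then have "fan_map (weights v x) = fan_map (weights v x')"
    by (auto simp: chart_def reflect_def split: if_splits)
  then have "weights v x = weights v x'"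
    using fan_map_inj weights_cone[OF assms] x by (auto dest: inj_onD)
  then show "x = x'" by (rule weights_inj[OF assms])
qed

text \<open>A continuous injection of the compact closed star into the plane has a continuous
  inverse, and this restricts to the open star.\<close>

lemma chart_homeomorphism:
  assumes v: "v \<in> cube_vertices n"
  obtains g where "homeomorphism (open_star v) (chart v ` open_star v) (chart v) g"
proof -
  obtain g where "homeomorphism (closed_star v) (chart v ` closed_star v) (chart v) g"
    using homeomorphism_compact[OF compact_closed_star[OF v] continuous_on_chart refl inj_on_chart[OF v]]
    by blast
  then have "homeomorphism (open_star v) (chart v ` open_star v) (chart v) g"
    by (rule homeomorphism_of_subsets) (use open_star_subset[OF v] in auto)
  then show thesis by (rule that)
qed

lemma surface_chart_vertex:
  assumes v: "v \<in> cube_vertices n"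
  shows "surface_chart (top_of_set (cycle_surface n)) (open_star v) (chart v)"
  unfolding surface_chart_def
proof (intro conjI)
  \<comment> \<open>Infinitely many conditions \<open>x i \<noteq> - v i\<close> would not obviously
    define an open set. From \<open>n\<close> on both coordinates are 1, so a finite intersection
    remains.\<close>
  have "open_star v = cycle_surface n \<inter> (\<Inter>i<n. {x. x i \<noteq> - v i})"
  proof -
    have "x i \<noteq> - v i" if "x \<in> cycle_surface n" "\<not> i < n" for x i
      using that v by (simp add: cycle_surface_def moment_angle_def cube_vertices_def)
    then show ?thesis by (auto simp: open_star_def)
  qed
  moreover have "open (\<Inter>i<n. {x :: nat \<Rightarrow> real. x i \<noteq> - v i})"
    by (intro open_INT ballI open_Collect_neq continuous_on_coordinate continuous_intros) auto
  ultimately show "openin (top_of_set (cycle_surface n)) (open_star v)"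
    by (auto simp: openin_open)
  have img: "chart v ` open_star v = reflect v ` fan_map ` {y \<in> cone. \<forall>i. y i < 2}"
    by (simp add: weights_open_star[OF v, symmetric] chart_def image_image)
  show "open (chart v ` open_star v)"
  proof (cases "(\<Prod>i<n. v i) = 1")
    case True
    then show ?thesis using open_fan_map_star unfolding img by (simp add: reflect_def)
  next
    case False
    have "cnj ` A = cnj -` A" for A by (auto simp: image_iff) (metis complex_cnj_cnj)
    moreover have "open (cnj -` (fan_map ` {y \<in> cone. \<forall>i. y i < 2}))"
      by (rule open_vimage[OF open_fan_map_star]) (intro continuous_intros)
    ultimately show ?thesis using False unfolding img by (simp add: reflect_def)
  qed
  obtain g where g: "homeomorphism (open_star v) (chart v ` open_star v) (chart v) g"
    using chart_homeomorphism[OF v] .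
  have "subtopology (top_of_set (cycle_surface n)) (open_star v) = top_of_set (open_star v)"
    by (simp add: subtopology_subtopology open_star_def Int_absorb1 Collect_mono)
  moreover have "homeomorphic_maps (top_of_set (open_star v)) (top_of_set (chart v ` open_star v)) (chart v) g"
    using g by (auto simp: homeomorphic_maps_def homeomorphism_def)
  ultimately show "homeomorphic_map (subtopology (top_of_set (cycle_surface n)) (open_star v))
      (top_of_set (chart v ` open_star v)) (chart v)"
    by (metis homeomorphic_map_maps)
qed

text \<open>Rounding the coordinates of a point to signs gives a vertex whose open star contains it;
  a coordinate 0 may be rounded either way.\<close>

lemma open_star_cover: "(\<Union>v \<in> cube_vertices n. open_star v) = cycle_surface n"
proof (intro equalityI subsetI)
  fix x assume x: "x \<in> cycle_surface n"
  define v :: "nat \<Rightarrow> real" where "v = (\<lambda>i. if x i \<ge> 0 then 1 else -1)"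
  have "x \<in> open_star v" using x by (auto simp: open_star_def v_def)
  moreover have "v \<in> cube_vertices n"
    using x by (auto simp: cube_vertices_def v_def cycle_surface_def moment_angle_def)
  ultimately show "x \<in> (\<Union>v \<in> cube_vertices n. open_star v)" by blast
qed (auto simp: open_star_def)

section \<open>Transition maps between the vertex charts\<close>

lemma fan_map_minus: "fan_map y' - fan_map y = (\<Sum>i<n. of_real (y' i - y i) * \<omega> ^ i)"
  by (simp add: fan_map_def sum_subtractf left_diff_distrib)

text \<open>At a coordinate where the vertices differ, a common point avoids both signs. Hence two
  stars meet only if the differing coordinates form a face of the cycle, which leaves no flip, one
  flip, or two flips at neighbouring indices.\<close>

lemma free_of_two_stars:
  assumes "v \<in> cube_vertices n" "w \<in> cube_vertices n" "x \<in> open_star v \<inter> open_star w"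
  shows "{i. v i \<noteq> w i} \<subseteq> free_coords x"
proof
  fix i assume "i \<in> {i. v i \<noteq> w i}"
  moreover have "x i \<noteq> - v i" "x i \<noteq> - w i" using assms(3) by (auto simp: open_star_def)
  ultimately show "i \<in> free_coords x"
    using cube_vertex_cases[OF assms(1), of i] cube_vertex_cases[OF assms(2), of i]
    by (auto simp: free_coords_def abs_if split: if_splits)
qed

lemma free_coords_cycle: "x \<in> open_star v \<Longrightarrow> free_coords x \<in> cycle_complex n"
  by (simp add: open_star_def cycle_surface_def moment_angle_def)

lemma weights_not_free:
  assumes "x \<in> open_star v" "i \<notin> free_coords x" "v \<in> cube_vertices n"
  shows "weights v x i = 0"
proof -
  have "x i \<noteq> - v i" "\<bar>x i\<bar> = 1" using assms by (auto simp: open_star_def free_coords_def)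
  then show ?thesis
    using cube_vertex_cases[OF assms(3), of i] by (auto simp: weights_def abs_if split: if_splits)
qed

lemma weights_nonneg: "v \<in> cube_vertices n \<Longrightarrow> x \<in> open_star v \<Longrightarrow> 0 \<le> weights v x i"
  using weights_cone[OF _ subsetD[OF open_star_subset]] by (simp add: cone_def)

lemma weights_flip: "v \<in> cube_vertices n \<Longrightarrow> w \<in> cube_vertices n \<Longrightarrow> v i \<noteq> w i \<Longrightarrow> weights w x i = 2 - weights v x i"
  using cube_vertex_cases[of v n i] cube_vertex_cases[of w n i] by (auto simp: weights_def)

lemma prod_flip:
  assumes "v \<in> cube_vertices n" "w \<in> cube_vertices n" "{i. v i \<noteq> w i} = D" "D \<subseteq> {..<n}"
  shows "(\<Prod>i<n. w i) = (-1) ^ card D * (\<Prod>i<n. v i)"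
proof -
  have "w i = (if i \<in> D then -1 else 1) * v i" for i
    using assms(3) cube_vertex_cases[OF assms(1), of i] cube_vertex_cases[OF assms(2), of i] by auto
  then have "(\<Prod>i<n. w i) = (\<Prod>i<n. (if i \<in> D then -1 else 1) * v i)" by (intro prod.cong) auto
  also have "\<dots> = (\<Prod>i<n. if i \<in> D then -1 else 1) * (\<Prod>i<n. v i)" by (rule prod.distrib)
  also have "(\<Prod>i<n. if i \<in> D then -1 else 1 :: real) = (\<Prod>i\<in>D. -1)"
    using assms(4) by (subst prod.inter_restrict[symmetric]) (auto simp: Int_absorb1)
  finally show ?thesis by simp
qed

text \<open>The common points lie in one open square, where only the two flipped coordinates are
  free. Flipping replaces both weights y by 2 - y, and the parity of the vertices agrees, so up to a
  translation the transition map is a half turn.\<close>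

lemma transition_two_flips:
  assumes v: "v \<in> cube_vertices n" and w: "w \<in> cube_vertices n"
    and k: "k < n" "{i. v i \<noteq> w i} = {k, Suc k mod n}"
    and x: "x \<in> open_star v \<inter> open_star w" "x' \<in> open_star v \<inter> open_star w"
  shows "chart w x' - chart w x = - (chart v x' - chart v x)"
proof -
  have neq: "Suc k mod n \<noteq> k" using Suc_mod_neq[OF k(1)] n_ge_3 by simp
  have eq: "weights w z i = (if i \<in> {k, Suc k mod n} then 2 else 0) - weights v z i"
    if z: "z \<in> open_star v \<inter> open_star w" for z i
  proof (cases "i \<in> {k, Suc k mod n}")
    case True
    then show ?thesis using weights_flip[OF v w, of i z] k(2) by auto
  next
    case False
    obtain l where l: "l < n" "free_coords z \<subseteq> {l, Suc l mod n}"
      using free_coords_cycle[of z v] z by (auto simp: cycle_complex_def)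
    have "{k, Suc k mod n} \<subseteq> free_coords z"
      using free_of_two_stars[OF v w z] k(2) by simp
    then have "{k, Suc k mod n} = {l, Suc l mod n}" using l(2) neq by auto
    then have "i \<notin> free_coords z" using l(2) False by auto
    then show ?thesis using False weights_not_free z v w by simp
  qed
  have "fan_map (weights w x') - fan_map (weights w x) = - (fan_map (weights v x') - fan_map (weights v x))"
    unfolding fan_map_minus sum_negf[symmetric] by (rule sum.cong) (simp_all add: eq[OF x(1)] eq[OF x(2)] algebra_simps)
  moreover have "(\<Prod>i<n. w i) = (\<Prod>i<n. v i)"
    using prod_flip[OF v w k(2)] neq Suc_mod_less[OF k(1)] k(1) by simp
  ultimately show ?thesis
    by (auto simp: chart_def reflect_def simp flip: complex_cnj_diff complex_cnj_minus)
qed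

text \<open>After rotation to the \<open>k\<close>-th spoke, flipping coordinate \<open>k\<close> and conjugating is, up to a
  translation, the negative of the shear \<open>x + \<i> y \<mapsto> x - 2 \<bar>y\<bar> cot \<theta> + \<i> y\<close>.  A shear changes a
  difference vector only horizontally, so it never reverses it.\<close>

lemma fan_map_flip:
  assumes v: "v \<in> cube_vertices n" and w: "w \<in> cube_vertices n"
    and k: "k < n" "{i. v i \<noteq> w i} = {k}"
    and x: "x \<in> open_star v \<inter> open_star w" "x' \<in> open_star v \<inter> open_star w" and s: "0 \<le> s"
    and eq: "cnj (fan_map (weights w x') - fan_map (weights w x))
       = of_real s * (cnj \<omega> ^ k * cnj \<omega> ^ k) * (fan_map (weights v x') - fan_map (weights v x))"
  shows "x' = x"
proof -
  obtain p where p: "p < n" "Suc p mod n = k"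
  proof (cases "k = 0")
    case True
    then show thesis using that[of "n - 1"] n_ge_3 by simp
  next
    case False
    then show thesis using that[of "k - 1"] k(1) by simp
  qed
  let ?q = "Suc k mod n"
  have q: "?q < n" using Suc_mod_less[OF k(1)] .
  have neq: "?q \<noteq> k" "p \<noteq> k" "p \<noteq> ?q"
    using Suc_mod_neq[OF k(1)] Suc_mod_neq[OF p(1)] Suc_mod_no_2_cycle[OF p(1) k(1)] p(2) n_ge_3 by auto
  \<comment> \<open>Coordinate k is free at a common point, so the point lies in one of the two
    squares at this spoke or on the edge between them, and at most one of the neighbours p and q has
    a nonzero weight.\<close>
  have supp: "(weights v z p = 0 \<or> weights v z ?q = 0) \<and> (\<forall>i. i \<notin> {p, k, ?q} \<longrightarrow> weights v z i = 0 \<and> weights w z i = 0)"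
    if z: "z \<in> open_star v \<inter> open_star w" for z
  proof -
    obtain l where l: "l < n" "free_coords z \<subseteq> {l, Suc l mod n}"
      using free_coords_cycle[of z v] z by (auto simp: cycle_complex_def)
    have "k \<in> free_coords z" using free_of_two_stars[OF v w z] k(2) by auto
    then have "l = k \<or> l = p" using l Suc_mod_inj[OF l(1) p(1)] p(2) by auto
    then have "free_coords z \<subseteq> {k, ?q} \<or> free_coords z \<subseteq> {p, k}" using l(2) p(2) by auto
    then have "(p \<notin> free_coords z \<or> ?q \<notin> free_coords z) \<and> free_coords z \<subseteq> {p, k, ?q}"
      using neq by auto
    moreover have "weights v z i = 0 \<and> weights w z i = 0" if "i \<notin> free_coords z" for i
      using weights_not_free[OF _ that] z v w by simp
    ultimately show ?thesis by blast
  qed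
  define d where "d = (\<lambda>i. weights v x' i - weights v x i)"
  have w_eq: "weights w z i = weights v z i" if "i \<noteq> k" for z i
  proof -
    have "v i = w i" using k(2) that by blast
    then show ?thesis by (simp add: weights_def)
  qed
  have w_k: "weights w z k = 2 - weights v z k" for z
    by (rule weights_flip[OF v w]) (use k(2) in blast)
  have pow: "\<omega> ^ k = \<omega> ^ p * \<omega>" "\<omega> ^ ?q = \<omega> ^ k * \<omega>"
    using omega_Suc_mod[OF p(1)] omega_Suc_mod[OF k(1)] p(2) by auto
  have pow_p: "\<omega> ^ p = \<omega> ^ k * cnj \<omega>"
    unfolding pow(1) by (simp add: omega_cnj mult.assoc)
  have three: "(\<Sum>i<n. of_real (f i) * \<omega> ^ i) = \<omega> ^ k * (of_real (f k) + of_real (f ?q) * \<omega> + of_real (f p) * cnj \<omega>)"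
    if "\<forall>i. i \<notin> {p, k, ?q} \<longrightarrow> f i = 0" for f :: "nat \<Rightarrow> real"
  proof -
    have "(\<Sum>i<n. of_real (f i) * \<omega> ^ i) = (\<Sum>i\<in>{p, k, ?q}. of_real (f i) * \<omega> ^ i)"
      by (rule sum.mono_neutral_right) (use that p(1) k(1) q in auto)
    also have "\<dots> = \<omega> ^ k * (of_real (f k) + of_real (f ?q) * \<omega> + of_real (f p) * cnj \<omega>)"
      using neq by (simp add: pow(2) pow_p algebra_simps)
    finally show ?thesis .
  qed
  have V: "fan_map (weights v x') - fan_map (weights v x)
      = \<omega> ^ k * (of_real (d k) + of_real (d ?q) * \<omega> + of_real (d p) * cnj \<omega>)"
    unfolding fan_map_minus d_def using supp[OF x(1)] supp[OF x(2)] by (intro three) auto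
  have W: "fan_map (weights w x') - fan_map (weights w x)
      = \<omega> ^ k * (of_real (- d k) + of_real (d ?q) * \<omega> + of_real (d p) * cnj \<omega>)"
    unfolding fan_map_minus
    by (subst three) (use supp[OF x(1)] supp[OF x(2)] neq in \<open>auto simp: d_def w_eq w_k\<close>)
  have "cnj \<omega> ^ k * (of_real (- d k) + of_real (d ?q) * cnj \<omega> + of_real (d p) * \<omega>)
      = of_real s * (cnj \<omega> ^ k * cnj \<omega> ^ k) * (\<omega> ^ k * (of_real (d k) + of_real (d ?q) * \<omega> + of_real (d p) * cnj \<omega>))"
    using eq unfolding V W by simp
  also have "\<dots> = cnj \<omega> ^ k * (cnj \<omega> ^ k * \<omega> ^ k) * (of_real s * (of_real (d k) + of_real (d ?q) * \<omega> + of_real (d p) * cnj \<omega>))"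
    by (simp only: mult_ac)
  also have "\<dots> = cnj \<omega> ^ k * (of_real s * (of_real (d k) + of_real (d ?q) * \<omega> + of_real (d p) * cnj \<omega>))"
    by (simp only: omega_cnj mult_1_right)
  finally have E: "of_real (- d k) + of_real (d ?q) * cnj \<omega> + of_real (d p) * \<omega>
      = of_real s * (of_real (d k) + of_real (d ?q) * \<omega> + of_real (d p) * cnj \<omega>)"
    by simp
  \<comment> \<open>The imaginary part of \<open>E\<close> is the component perpendicular to the
    k-th spoke, which the shear preserves.\<close>
  have "(d p - d ?q) * sin \<theta> = s * ((d ?q - d p) * sin \<theta>)"
    using arg_cong[OF E, of Im] by (simp add: algebra_simps)
  then have "((1 + s) * (d p - d ?q)) * sin \<theta> = 0" by (simp add: algebra_simps)
  then have "(1 + s) * (d p - d ?q) = 0" using sin_theta_pos by simp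
  then have dpq: "d p = d ?q" using s by simp
  \<comment> \<open>At each point at most one of the nonnegative weights at p and q is nonzero, so
    their difference determines both. The equal increments leave this difference unchanged.\<close>
  have "d p = 0 \<and> d ?q = 0"
    using dpq supp[OF x(1)] supp[OF x(2)] weights_nonneg[OF v, of x p] weights_nonneg[OF v, of x' p]
      weights_nonneg[OF v, of x ?q] weights_nonneg[OF v, of x' ?q] x
    unfolding d_def by auto
  moreover from this have "- d k = s * d k"
    using arg_cong[OF E, of Re] by simp
  then have "(1 + s) * d k = 0" by (simp add: algebra_simps)
  then have "d k = 0" using s by simp
  ultimately have "weights v x' i = weights v x i" for i
    using supp[OF x(1)] supp[OF x(2)] by (cases "i \<in> {p, k, ?q}") (auto simp: d_def)
  then show ?thesis using weights_inj[OF v] by blast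
qed

text \<open>The hypothesis of \<open>orientation_preserving_onI\<close> for the transition map from \<open>v\<close> to \<open>w\<close>.\<close>

definition transition_direction :: "(nat \<Rightarrow> real) \<Rightarrow> (nat \<Rightarrow> real) \<Rightarrow> complex \<Rightarrow> bool" where
  "transition_direction v w c \<longleftrightarrow> c \<noteq> 0 \<and>
     (\<forall>x \<in> open_star v \<inter> open_star w. \<forall>x' \<in> open_star v \<inter> open_star w. \<forall>s \<ge> 0.
        chart w x' - chart w x = - of_real s * (c * (chart v x' - chart v x)) \<longrightarrow> x' = x)"

lemma chart_eq_of_opposite:
  assumes v: "v \<in> cube_vertices n" and x: "x \<in> open_star v" "x' \<in> open_star v" and s: "0 \<le> s"
    and eq: "chart v x' - chart v x = - of_real s * (chart v x' - chart v x)"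
  shows "x' = x"
proof -
  have "complex_of_real (1 + s) * (chart v x' - chart v x) = 0"
    using eq by (simp add: algebra_simps)
  moreover have "complex_of_real (1 + s) \<noteq> 0" using s by (simp only: of_real_eq_0_iff)
  ultimately have "chart v x' = chart v x" by simp
  moreover have "x \<in> closed_star v" "x' \<in> closed_star v" using x open_star_subset[OF v] by blast+
  ultimately show ?thesis using inj_onD[OF inj_on_chart[OF v]] by blast
qed

lemma transition_direction_refl: "v \<in> cube_vertices n \<Longrightarrow> transition_direction v v 1"
  unfolding transition_direction_def using chart_eq_of_opposite[of v] by simp

lemma transition_direction_two_flips:
  assumes v: "v \<in> cube_vertices n" and w: "w \<in> cube_vertices n"
    and k: "k < n" "{i. v i \<noteq> w i} = {k, Suc k mod n}"
  shows "transition_direction v w (- 1)"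
  unfolding transition_direction_def
proof (intro conjI ballI allI impI)
  fix x x' and s :: real
  assume x: "x \<in> open_star v \<inter> open_star w" "x' \<in> open_star v \<inter> open_star w" and s: "0 \<le> s"
    and eq: "chart w x' - chart w x = - of_real s * (- 1 * (chart v x' - chart v x))"
  have "- (chart v x' - chart v x) = - of_real s * (- 1 * (chart v x' - chart v x))"
    using eq unfolding transition_two_flips[OF v w k x] .
  then have "chart v x' - chart v x = - of_real s * (chart v x' - chart v x)"
    by (metis mult_minus1 mult_minus_right neg_equal_iff_equal)
  then show "x' = x" using chart_eq_of_opposite[OF v _ _ s] x by blast
qed simp

text \<open>The constant is the factor by which displacements along the k-th spoke are multiplied:
  the flip negates the weight k, and since exactly one of the two charts is mirrored,
  \<open>\<omega> ^ k\<close> and its conjugate are exchanged. Which vertex is the odd one decides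
  between the two conjugate constants.\<close>

lemma transition_direction_one_flip:
  assumes v: "v \<in> cube_vertices n" and w: "w \<in> cube_vertices n"
    and k: "k < n" "{i. v i \<noteq> w i} = {k}"
  obtains c where "transition_direction v w c"
proof (cases "(\<Prod>i<n. v i) = 1")
  case True
  then have sgn: "(\<Prod>i<n. w i) \<noteq> 1" using prod_flip[OF v w k(2)] k(1) by simp
  have "transition_direction v w (- (cnj \<omega> ^ k * cnj \<omega> ^ k))"
    unfolding transition_direction_def
  proof (intro conjI ballI allI impI)
    fix x x' and s :: real
    assume x: "x \<in> open_star v \<inter> open_star w" "x' \<in> open_star v \<inter> open_star w" "0 \<le> s"
      and eq: "chart w x' - chart w x = - of_real s * (- (cnj \<omega> ^ k * cnj \<omega> ^ k) * (chart v x' - chart v x))"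
    show "x' = x"
      by (rule fan_map_flip[OF v w k x]) (use eq True sgn in \<open>simp add: chart_def reflect_def\<close>)
  qed simp
  then show thesis by (rule that)
next
  case False
  then have sgn: "(\<Prod>i<n. w i) = 1"
    using prod_flip[OF v w k(2)] k(1) cube_vertex_prod_cases[OF v, of "{..<n}"] by simp
  have "transition_direction v w (- (\<omega> ^ k * \<omega> ^ k))"
    unfolding transition_direction_def
  proof (intro conjI ballI allI impI)
    fix x x' and s :: real
    assume x: "x \<in> open_star v \<inter> open_star w" "x' \<in> open_star v \<inter> open_star w" "0 \<le> s"
      and eq: "chart w x' - chart w x = - of_real s * (- (\<omega> ^ k * \<omega> ^ k) * (chart v x' - chart v x))"
    have "cnj (chart w x' - chart w x) = cnj (- of_real s * (- (\<omega> ^ k * \<omega> ^ k) * (chart v x' - chart v x)))"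
      by (simp only: eq)
    then show "x' = x"
      by (intro fan_map_flip[OF v w k x]) (use False sgn in \<open>simp add: chart_def reflect_def\<close>)
  qed simp
  then show thesis by (rule that)
qed

lemma transition_direction_exists:
  assumes v: "v \<in> cube_vertices n" and w: "w \<in> cube_vertices n"
  shows "\<exists>c. transition_direction v w c"
proof (cases "open_star v \<inter> open_star w = {}")
  case True
  then have "transition_direction v w 1" by (simp add: transition_direction_def)
  then show ?thesis ..
next
  case False
  then obtain x where x: "x \<in> open_star v \<inter> open_star w" by blast
  then have "free_coords x \<in> cycle_complex n" using free_coords_cycle by blast
  then have "{i. v i \<noteq> w i} \<in> cycle_complex n"
    using down_closedD[OF down_closed_cycle_complex] free_of_two_stars[OF v w x] by blast
  then have "{i. v i \<noteq> w i} = {} \<or> (\<exists>k<n. {i. v i \<noteq> w i} = {k}) \<or> (\<exists>k<n. {i. v i \<noteq> w i} = {k, Suc k mod n})"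
    unfolding cycle_complex_alt[OF n_ge_3] by blast
  then show ?thesis
  proof (elim disjE exE conjE)
    assume "{i. v i \<noteq> w i} = {}"
    then have "v = w" by (simp add: fun_eq_iff)
    then show ?thesis using transition_direction_refl[OF v] by blast
  next
    fix k assume "k < n" "{i. v i \<noteq> w i} = {k}"
    then show ?thesis using transition_direction_one_flip[OF v w] by metis
  next
    fix k assume "k < n" "{i. v i \<noteq> w i} = {k, Suc k mod n}"
    then show ?thesis using transition_direction_two_flips[OF v w] by metis
  qed
qed

lemma orientation_preserving_transition:
  assumes v: "v \<in> cube_vertices n" and w: "w \<in> cube_vertices n"
  shows "orientation_preserving_on (chart v ` (open_star v \<inter> open_star w)) (chart w \<circ> inv_into (open_star v) (chart v))"
proof -
  obtain g where g: "homeomorphism (open_star v) (chart v ` open_star v) (chart v) g"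
    using chart_homeomorphism[OF v] .
  have inj: "inj_on (chart v) (open_star v)"
    using inj_on_chart[OF v] open_star_subset[OF v] by (rule inj_on_subset)
  have inv: "inv_into (open_star v) (chart v) (chart v x) = x" if "x \<in> open_star v" for x
    using inj that by simp
  obtain c where "transition_direction v w c"
    using transition_direction_exists[OF v w] by blast
  then have c: "c \<noteq> 0"
    "\<And>x x' s. x \<in> open_star v \<inter> open_star w \<Longrightarrow> x' \<in> open_star v \<inter> open_star w \<Longrightarrow> 0 \<le> s \<Longrightarrow>
       chart w x' - chart w x = - of_real s * (c * (chart v x' - chart v x)) \<Longrightarrow> x' = x"
    unfolding transition_direction_def by blast+
  show ?thesis
  proof (rule orientation_preserving_onI[OF _ c(1)])
    have "continuous_on (chart v ` open_star v) (inv_into (open_star v) (chart v))"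
    proof (rule continuous_on_eq)
      show "continuous_on (chart v ` open_star v) g" using g by (simp add: homeomorphism_def)
      show "g y = inv_into (open_star v) (chart v) y" if "y \<in> chart v ` open_star v" for y
        using g that inv by (auto simp: homeomorphism_def)
    qed
    then have "continuous_on (chart v ` (open_star v \<inter> open_star w)) (inv_into (open_star v) (chart v))"
      by (rule continuous_on_subset) auto
    then show "continuous_on (chart v ` (open_star v \<inter> open_star w)) (chart w \<circ> inv_into (open_star v) (chart v))"
      by (rule continuous_on_compose) (rule continuous_on_chart)
  next
    fix z z' and s :: real
    assume "z \<in> chart v ` (open_star v \<inter> open_star w)" "z' \<in> chart v ` (open_star v \<inter> open_star w)" "0 \<le> s"
      and eq: "(chart w \<circ> inv_into (open_star v) (chart v)) z' - (chart w \<circ> inv_into (open_star v) (chart v)) z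
        = - of_real s * (c * (z' - z))"
    moreover from this obtain x x' where "x \<in> open_star v \<inter> open_star w" "z = chart v x"
      "x' \<in> open_star v \<inter> open_star w" "z' = chart v x'" by blast
    ultimately show "z' = z" using c(2)[of x x' s] inv by auto
  qed
qed

section \<open>The closed orientable surface and its genus\<close>

lemma orientable_cycle_surface: "orientable_surface (top_of_set (cycle_surface n))"
  unfolding orientable_surface_def
proof (intro exI conjI)
  let ?A = "(\<lambda>v. (open_star v, chart v)) ` cube_vertices n"
  show "\<forall>(U, \<phi>) \<in> ?A. surface_chart (top_of_set (cycle_surface n)) U \<phi>"
    using surface_chart_vertex by auto
  show "(\<Union>(U, \<phi>) \<in> ?A. U) = topspace (top_of_set (cycle_surface n))"
    using open_star_cover by simp
  show "\<forall>(U, \<phi>)\<in>?A. \<forall>(V, \<psi>)\<in>?A. orientation_preserving_on (\<phi> ` (U \<inter> V)) (\<psi> \<circ> inv_into U \<phi>)"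
    using orientation_preserving_transition by auto
qed

lemma two_manifold_cycle_surface: "two_manifold (top_of_set (cycle_surface n))"
  unfolding two_manifold_def
proof (intro conjI ballI)
  show "Hausdorff_space (top_of_set (cycle_surface n))"
    by (simp add: Hausdorff_space_subtopology)
  show "second_countable (top_of_set (cycle_surface n))"
  proof (rule second_countable_subtopology)
    obtain B :: "(nat \<Rightarrow> real) set set" where B: "countable B" "\<And>C. C \<in> B \<Longrightarrow> open C"
      "\<And>S. open S \<Longrightarrow> \<exists>U. U \<subseteq> B \<and> S = \<Union>U"
      by (rule univ_second_countable) blast
    have "\<exists>U\<in>B. x \<in> U \<and> U \<subseteq> W" if "open W" "x \<in> W" for W x
      using B(3)[OF that(1)] that(2) by blast
    then show "second_countable (euclidean :: (nat \<Rightarrow> real) topology)"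
      unfolding second_countable_def using B(1,2) by (intro exI[of _ B]) auto
  qed
  fix x assume "x \<in> topspace (top_of_set (cycle_surface n))"
  then have "x \<in> (\<Union>v \<in> cube_vertices n. open_star v)"
    unfolding open_star_cover by simp
  then obtain v where "v \<in> cube_vertices n" "x \<in> open_star v" by blast
  then show "\<exists>U \<phi>. x \<in> U \<and> surface_chart (top_of_set (cycle_surface n)) U \<phi>"
    using surface_chart_vertex by blast
qed

end

lemma surface_of_genus_cycle_surface:
  assumes "n \<ge> 3"
  shows "surface_of_genus (top_of_set (cycle_surface n)) (1 + (int n - 4) * 2 ^ (n - 3))"
proof -
  interpret polygon_sectors n by unfold_locales fact
  have K: "{} \<in> cycle_complex n" "\<And>i. i < n \<Longrightarrow> {i} \<in> cycle_complex n"
    using cycle_complex_alt[OF assms] by auto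
  have "(\<lambda>_. 1) \<in> cycle_surface n"
    using K(1) by (simp add: cycle_surface_def moment_angle_def free_coords_def)
  moreover have "compact (cycle_surface n)" "connected (cycle_surface n)"
    unfolding cycle_surface_def
    using compact_moment_angle connected_moment_angle down_closed_cycle_complex K by blast+
  ultimately have "closed_orientable_surface (top_of_set (cycle_surface n))"
    using two_manifold_cycle_surface orientable_cycle_surface
    by (auto simp: closed_orientable_surface_def compact_space_subtopology connected_space_subtopology)
  moreover have "has_euler_characteristic (top_of_set (cycle_surface n)) (2 - 2 * (1 + (int n - 4) * 2 ^ (n - 3)))"
    unfolding has_euler_characteristic_iff
    using euler_moment_angle[OF down_closed_cycle_complex, of n n] moment_angle_euler_cycle[OF assms]
    by (simp add: cycle_surface_def)
  ultimately show ?thesis by (simp add: surface_of_genus_def)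
qed

section \<open>The cube graph in the surface\<close>

definition sign_of :: "bool \<Rightarrow> real" where
  "sign_of b = (if b then 1 else -1)"

lemma sign_of_simps [simp]: "\<bar>sign_of b\<bar> = 1" "sign_of b * sign_of b = 1" "sign_of (\<not> b) = - sign_of b"
  by (auto simp: sign_of_def)

definition flip_bit :: "nat \<Rightarrow> bool list \<Rightarrow> bool list" where
  "flip_bit i u = u[i := \<not> u ! i]"

lemma flip_bit_vertex [simp]: "flip_bit i u \<in> hypercube_vertices n \<longleftrightarrow> u \<in> hypercube_vertices n"
  by (simp add: flip_bit_def hypercube_vertices_def)

lemma nth_flip_bit:
  "u \<in> hypercube_vertices n \<Longrightarrow> i < n \<Longrightarrow> j < n \<Longrightarrow> flip_bit i u ! j = (if j = i then \<not> u ! i else u ! j)"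
  by (simp add: flip_bit_def hypercube_vertices_def nth_list_update)

lemma flip_bit_neq: "u \<in> hypercube_vertices n \<Longrightarrow> i < n \<Longrightarrow> flip_bit i u \<noteq> u"
  using nth_flip_bit[of u n i i] by auto

lemma finite_hypercube_vertices: "finite (hypercube_vertices n)"
  using finite_lists_length_eq[of "UNIV :: bool set" n] by (simp add: hypercube_vertices_def)

lemma hypercube_vertices_eqI:
  "u \<in> hypercube_vertices n \<Longrightarrow> w \<in> hypercube_vertices n \<Longrightarrow> (\<And>j. j < n \<Longrightarrow> u ! j = w ! j) \<Longrightarrow> u = w"
  by (simp add: hypercube_vertices_def list_eq_iff_nth_eq)

lemma hypercube_edges_eq:
  "hypercube_edges n = {{u, flip_bit i u} | u i. u \<in> hypercube_vertices n \<and> i < n}"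
proof (intro equalityI subsetI)
  fix e assume "e \<in> hypercube_edges n"
  then obtain u v where uv: "u \<in> hypercube_vertices n" "v \<in> hypercube_vertices n"
    "card {i. i < n \<and> u ! i \<noteq> v ! i} = 1" "e = {u, v}"
    by (auto simp: hypercube_edges_def)
  then obtain i where i: "{i. i < n \<and> u ! i \<noteq> v ! i} = {i}"
    by (auto simp: card_1_singleton_iff)
  then have "i < n" by blast
  have "v = flip_bit i u"
  proof (rule hypercube_vertices_eqI)
    fix j assume "j < n"
    have "u ! j \<noteq> v ! j \<longleftrightarrow> j = i" using i \<open>j < n\<close> by blast
    then show "v ! j = flip_bit i u ! j"
      using nth_flip_bit[OF uv(1) \<open>i < n\<close> \<open>j < n\<close>] by auto
  qed (use uv in auto)
  then show "e \<in> {{u, flip_bit i u} | u i. u \<in> hypercube_vertices n \<and> i < n}"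
    using uv \<open>i < n\<close> by blast
next
  fix e assume "e \<in> {{u, flip_bit i u} | u i. u \<in> hypercube_vertices n \<and> i < n}"
  then obtain u i where ui: "u \<in> hypercube_vertices n" "i < n" "e = {u, flip_bit i u}" by blast
  have "{j. j < n \<and> u ! j \<noteq> flip_bit i u ! j} = {i}"
    using nth_flip_bit[OF ui(1,2)] ui(2) by (auto split: if_splits)
  then show "e \<in> hypercube_edges n"
    using ui flip_bit_vertex[of i u n] unfolding hypercube_edges_def
    by (intro CollectI exI[of _ u] exI[of _ "flip_bit i u"]) simp
qed

text \<open>The affine extension, in barycentric coordinates, of the map that reads a bit string as
  a vertex of the cube; the later coordinates are pinned as in \<open>moment_angle\<close>.\<close>

definition cube_embedding :: "nat \<Rightarrow> (bool list \<Rightarrow> real) \<Rightarrow> nat \<Rightarrow> real" where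
  "cube_embedding n t = (\<lambda>i. if i < n then \<Sum>u\<in>hypercube_vertices n. t u * sign_of (u ! i) else 1)"

definition edge_point :: "nat \<Rightarrow> bool list \<Rightarrow> real \<Rightarrow> bool list \<Rightarrow> real" where
  "edge_point i u a = (\<lambda>w. if w = u then a else if w = flip_bit i u then 1 - a else 0)"

lemma sum_edge_point:
  assumes "u \<in> hypercube_vertices n" "i < n"
  shows "(\<Sum>w\<in>hypercube_vertices n. edge_point i u a w * g w) = a * g u + (1 - a) * g (flip_bit i u)"
proof -
  have "(\<Sum>w\<in>hypercube_vertices n. edge_point i u a w * g w) = (\<Sum>w\<in>{u, flip_bit i u}. edge_point i u a w * g w)"
    by (rule sum.mono_neutral_right) (use assms finite_hypercube_vertices in \<open>auto simp: edge_point_def\<close>)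
  then show ?thesis using flip_bit_neq[OF assms] by (simp add: edge_point_def)
qed

text \<open>For n > 0 every vertex lies on an edge, so vertices are edge points as well and later
  arguments have a single case.\<close>

lemma topspace_cube_realization:
  assumes "n > 0"
  shows "topspace (graph_realization (hypercube_vertices n) (hypercube_edges n))
     = {edge_point i u a | i u a. u \<in> hypercube_vertices n \<and> i < n \<and> 0 \<le> a \<and> a \<le> 1}" (is "?T = ?P")
proof (intro equalityI subsetI)
  fix t assume "t \<in> ?T"
  then have t: "\<And>v. 0 \<le> t v" "(\<Sum>v\<in>hypercube_vertices n. t v) = 1"
    and supp: "(\<exists>v\<in>hypercube_vertices n. {x. t x \<noteq> 0} \<subseteq> {v}) \<or> (\<exists>e\<in>hypercube_edges n. {x. t x \<noteq> 0} \<subseteq> e)"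
    by (auto simp: graph_realization_def)
  from supp obtain u i where ui: "u \<in> hypercube_vertices n" "i < n" "{x. t x \<noteq> 0} \<subseteq> {u, flip_bit i u}"
  proof
    assume "\<exists>v\<in>hypercube_vertices n. {x. t x \<noteq> 0} \<subseteq> {v}"
    then show thesis using that assms by blast
  next
    assume "\<exists>e\<in>hypercube_edges n. {x. t x \<noteq> 0} \<subseteq> e"
    then show thesis using that unfolding hypercube_edges_eq by blast
  qed
  have "(\<Sum>v\<in>hypercube_vertices n. t v) = (\<Sum>v\<in>{u, flip_bit i u}. t v)"
    by (rule sum.mono_neutral_right) (use ui finite_hypercube_vertices in auto)
  then have sum: "t u + t (flip_bit i u) = 1"
    using t(2) flip_bit_neq[OF ui(1,2)] by simp
  have "t = edge_point i u (t u)"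
  proof
    fix w show "t w = edge_point i u (t u) w"
      using ui(3) sum by (auto simp: edge_point_def)
  qed
  moreover have "t u \<le> 1" using sum t(1)[of "flip_bit i u"] by simp
  ultimately show "t \<in> ?P" using ui t(1) by blast
next
  fix t assume "t \<in> ?P"
  then obtain i u a where t: "t = edge_point i u a" "u \<in> hypercube_vertices n" "i < n" "0 \<le> a" "a \<le> 1" by blast
  have "(\<Sum>v\<in>hypercube_vertices n. t v) = 1"
    using sum_edge_point[OF t(2,3), of a "\<lambda>_. 1"] t(1) by simp
  moreover have "{u, flip_bit i u} \<in> hypercube_edges n" using t unfolding hypercube_edges_eq by blast
  moreover have "{x. t x \<noteq> 0} \<subseteq> {u, flip_bit i u}" by (auto simp: t(1) edge_point_def)
  moreover have "\<forall>v. 0 \<le> t v" using t by (simp add: edge_point_def)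
  ultimately show "t \<in> ?T" by (auto simp: graph_realization_def)
qed

lemma cube_embedding_edge_point:
  assumes "u \<in> hypercube_vertices n" "i < n"
  shows "cube_embedding n (edge_point i u a)
     = (\<lambda>j. if j = i then (2 * a - 1) * sign_of (u ! i) else if j < n then sign_of (u ! j) else 1)"
proof
  fix j show "cube_embedding n (edge_point i u a) j
     = (if j = i then (2 * a - 1) * sign_of (u ! i) else if j < n then sign_of (u ! j) else 1)"
  proof (cases "j < n")
    case True
    then have "cube_embedding n (edge_point i u a) j = a * sign_of (u ! j) + (1 - a) * sign_of (flip_bit i u ! j)"
      using sum_edge_point[OF assms, of a "\<lambda>w. sign_of (w ! j)"] by (simp add: cube_embedding_def)
    then show ?thesis
      using True nth_flip_bit[OF assms True] by (cases "j = i") (simp_all add: algebra_simps)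
  qed (use assms in \<open>simp add: cube_embedding_def\<close>)
qed

text \<open>The product is the weight of the vertex \<open>w\<close> in multilinear interpolation on
  the cube. On an edge all factors except the i-th are 0 or 1. The formula recovers barycentric
  coordinates from the image point, so injectivity follows without comparing pairs of edges.\<close>

lemma edge_point_eq_prod:
  assumes "u \<in> hypercube_vertices n" "i < n" "w \<in> hypercube_vertices n"
  shows "edge_point i u a w = (\<Prod>j<n. (1 + sign_of (w ! j) * cube_embedding n (edge_point i u a) j) / 2)"
proof (cases "\<exists>j<n. j \<noteq> i \<and> w ! j \<noteq> u ! j")
  case True
  then obtain j where j: "j < n" "j \<noteq> i" "w ! j \<noteq> u ! j" by blast
  then have "w \<noteq> u" "w \<noteq> flip_bit i u" using nth_flip_bit[OF assms(1,2), of j] by auto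
  moreover have "(1 + sign_of (w ! j) * cube_embedding n (edge_point i u a) j) / 2 = 0"
    using j by (simp add: cube_embedding_edge_point[OF assms(1,2)] sign_of_def)
  then have "(\<Prod>j<n. (1 + sign_of (w ! j) * cube_embedding n (edge_point i u a) j) / 2) = 0"
    using j(1) by (intro prod_zero) auto
  ultimately show ?thesis by (simp add: edge_point_def)
next
  case False
  have "(\<Prod>j<n. (1 + sign_of (w ! j) * cube_embedding n (edge_point i u a) j) / 2)
      = (\<Prod>j\<in>{i}. (1 + sign_of (w ! j) * cube_embedding n (edge_point i u a) j) / 2)"
    by (rule prod.mono_neutral_right)
      (use False assms(2) in \<open>auto simp: cube_embedding_edge_point[OF assms(1,2)]\<close>)
  also have "\<dots> = (1 + (2 * a - 1) * (sign_of (w ! i) * sign_of (u ! i))) / 2"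
    by (simp add: cube_embedding_edge_point[OF assms(1,2)] algebra_simps)
  also have "\<dots> = edge_point i u a w"
  proof (cases "w ! i = u ! i")
    case True
    then have "w = u" using False by (intro hypercube_vertices_eqI[OF assms(3,1)]) metis
    then show ?thesis by (simp add: edge_point_def)
  next
    case neq: False
    then have "w = flip_bit i u"
      using False nth_flip_bit[OF assms(1,2)] assms by (intro hypercube_vertices_eqI[OF assms(3)]) auto
    moreover have "sign_of (w ! i) * sign_of (u ! i) = -1" using neq by (auto simp: sign_of_def)
    ultimately show ?thesis using flip_bit_neq[OF assms(1,2)] by (simp add: edge_point_def)
  qed
  finally show ?thesis by simp
qed

definition cube_skeleton :: "nat \<Rightarrow> (nat \<Rightarrow> real) set" where
  "cube_skeleton n = {x \<in> cycle_surface n. \<exists>i. free_coords x \<subseteq> {i}}"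

context polygon_sectors
begin

lemma cube_embedding_image:
  "cube_embedding n ` topspace (graph_realization (hypercube_vertices n) (hypercube_edges n)) = cube_skeleton n"
proof -
  have "0 < n" using n_ge_3 by simp
  show ?thesis
    unfolding topspace_cube_realization[OF \<open>0 < n\<close>]
  proof (intro equalityI subsetI)
    fix x assume "x \<in> cube_embedding n ` {edge_point i u a |i u a. u \<in> hypercube_vertices n \<and> i < n \<and> 0 \<le> a \<and> a \<le> 1}"
    then obtain i u a where u: "u \<in> hypercube_vertices n" "i < n" and a: "0 \<le> a" "a \<le> 1"
      and x: "x = cube_embedding n (edge_point i u a)" by blast
    note x = x[unfolded cube_embedding_edge_point[OF u]]
    have free: "free_coords x \<subseteq> {i}" by (auto simp: x free_coords_def)
    have "{i} \<in> cycle_complex n" using cycle_complex_alt[OF n_ge_3] u(2) by blast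
    then have "free_coords x \<in> cycle_complex n" using down_closedD[OF down_closed_cycle_complex] free by blast
    moreover have "\<bar>2 * a - 1\<bar> \<le> 1" using a by (simp add: abs_le_iff)
    then have "\<bar>x j\<bar> \<le> 1" for j by (simp add: x abs_mult)
    moreover have "x j = 1" if "j \<ge> n" for j using that u(2) by (simp add: x)
    ultimately show "x \<in> cube_skeleton n"
      using free by (auto simp: cube_skeleton_def cycle_surface_def moment_angle_def)
  next
    fix x assume "x \<in> cube_skeleton n"
    then obtain i0 where x: "x \<in> moment_angle n (cycle_complex n)" "free_coords x \<subseteq> {i0}"
      by (auto simp: cube_skeleton_def cycle_surface_def)
    obtain i where i: "i < n" "free_coords x \<subseteq> {i}"
    proof (cases "free_coords x = {}")
      case False
      then have "i0 \<in> free_coords x" using x(2) by blast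
      then show thesis using that[of i0] x(2) free_coords_subset[OF x(1)] by blast
    qed (use that[of 0] n_ge_3 in auto)
    have bound: "\<bar>x j\<bar> \<le> 1" "j \<ge> n \<Longrightarrow> x j = 1" for j using x(1) by (auto simp: moment_angle_def)
    define u where "u = map (\<lambda>j. x j = 1) [0..<n]"
    have u: "u \<in> hypercube_vertices n" by (simp add: u_def hypercube_vertices_def)
    have nth: "u ! j = (x j = 1)" if "j < n" for j using that by (simp add: u_def)
    \<comment> \<open>Solved from x i = (2 a - 1) \<open>sign_of (u ! i)\<close>. If coordinate i is
      free, its bit is False, and \<open>a\<close> is the weight of that end of the edge.\<close>
    define a where "a = (1 + sign_of (u ! i) * x i) / 2"
    have "0 \<le> a" "a \<le> 1" using bound(1)[of i] by (auto simp: a_def sign_of_def)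
    moreover have "x = cube_embedding n (edge_point i u a)"
      unfolding cube_embedding_edge_point[OF u i(1)]
    proof
      fix j
      show "x j = (if j = i then (2 * a - 1) * sign_of (u ! i) else if j < n then sign_of (u ! j) else 1)"
      proof (cases "j = i")
        case True
        have "2 * a - 1 = sign_of (u ! i) * x i" by (simp add: a_def field_simps)
        then have "(2 * a - 1) * sign_of (u ! i) = x i * (sign_of (u ! i) * sign_of (u ! i))"
          by (simp only: mult_ac)
        then show ?thesis using True by simp
      next
        case False
        then have "\<bar>x j\<bar> = 1" using i(2) by (auto simp: free_coords_def)
        then show ?thesis using False bound(2)[of j] nth[of j] by (auto simp: sign_of_def)
      qed
    qed
    ultimately show "x \<in> cube_embedding n ` {edge_point i u a |i u a. u \<in> hypercube_vertices n \<and> i < n \<and> 0 \<le> a \<and> a \<le> 1}"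
      using u i(1) by blast
  qed
qed

lemma cube_embedding_inj:
  "inj_on (cube_embedding n) (topspace (graph_realization (hypercube_vertices n) (hypercube_edges n)))"
proof (rule inj_onI)
  fix t t' assume t: "t \<in> topspace (graph_realization (hypercube_vertices n) (hypercube_edges n))"
    and t': "t' \<in> topspace (graph_realization (hypercube_vertices n) (hypercube_edges n))"
    and eq: "cube_embedding n t = cube_embedding n t'"
  have "0 < n" using n_ge_3 by simp
  have formula: "s w = (if w \<in> hypercube_vertices n then \<Prod>j<n. (1 + sign_of (w ! j) * cube_embedding n s j) / 2 else 0)"
    if s: "s \<in> topspace (graph_realization (hypercube_vertices n) (hypercube_edges n))" for s w
  proof -
    obtain i u a where u: "u \<in> hypercube_vertices n" "i < n" and s_eq: "s = edge_point i u a"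
      using s unfolding topspace_cube_realization[OF \<open>0 < n\<close>] by blast
    show ?thesis
    proof (cases "w \<in> hypercube_vertices n")
      case True
      then show ?thesis using edge_point_eq_prod[OF u True, of a] by (simp add: s_eq)
    next
      case False
      then have "w \<noteq> u" "w \<noteq> flip_bit i u" using u by auto
      then show ?thesis using False by (simp add: s_eq edge_point_def)
    qed
  qed
  show "t = t'"
  proof
    fix w show "t w = t' w" by (subst formula[OF t], subst formula[OF t'], subst eq) (rule refl)
  qed
qed

lemma graph_embedding_cube:
  "graph_embedding (hypercube_vertices n) (hypercube_edges n) (top_of_set (cycle_surface n)) (cube_embedding n)"
  unfolding graph_embedding_def
proof
  have coord: "continuous_on T (\<lambda>t :: bool list \<Rightarrow> real. t u)" for T u
    using continuous_on_product_coordinates[of u] continuous_on_subset by blast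
  have "continuous_on T (cube_embedding n)" for T
  proof (rule continuous_on_coordinatewise_then_product)
    fix i show "continuous_on T (\<lambda>t. cube_embedding n t i)"
      unfolding cube_embedding_def by (cases "i < n") (simp_all add: continuous_intros coord)
  qed
  moreover have "cube_embedding n ` topspace (graph_realization (hypercube_vertices n) (hypercube_edges n)) \<subseteq> cycle_surface n"
    unfolding cube_embedding_image by (auto simp: cube_skeleton_def)
  ultimately show "continuous_map (graph_realization (hypercube_vertices n) (hypercube_edges n))
      (top_of_set (cycle_surface n)) (cube_embedding n)"
    unfolding graph_realization_def by (auto simp: image_subset_iff)
qed (rule cube_embedding_inj)

section \<open>The faces\<close>

text \<open>A square is named by any of its points; by \<open>open_square_eq\<close> these sets
  partition the complement of the skeleton.\<close>

definition open_square :: "(nat \<Rightarrow> real) \<Rightarrow> (nat \<Rightarrow> real) set" where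
  "open_square x = {y. free_coords y = free_coords x \<and> (\<forall>i. \<bar>y i\<bar> \<le> 1) \<and> (\<forall>i. i \<notin> free_coords x \<longrightarrow> y i = x i)}"

lemma complement_skeleton_free:
  assumes "x \<in> cycle_surface n - cube_skeleton n"
  obtains k where "k < n" "free_coords x = {k, Suc k mod n}"
proof -
  have "free_coords x \<in> cycle_complex n"
    using assms by (simp add: cycle_surface_def moment_angle_def)
  moreover have "\<not> free_coords x \<subseteq> {i}" for i
    using assms by (auto simp: cube_skeleton_def)
  ultimately show thesis
    using that unfolding cycle_complex_alt[OF n_ge_3] by blast
qed

lemma open_square_self: "x \<in> cycle_surface n \<Longrightarrow> x \<in> open_square x"
  by (simp add: open_square_def cycle_surface_def moment_angle_def)

lemma open_square_subset:
  assumes "x \<in> cycle_surface n - cube_skeleton n"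
  shows "open_square x \<subseteq> cycle_surface n - cube_skeleton n"
proof
  fix y assume y: "y \<in> open_square x"
  have x: "\<And>i. i \<ge> n \<Longrightarrow> x i = 1" "free_coords x \<in> cycle_complex n" "\<And>i. \<not> free_coords x \<subseteq> {i}"
    using assms by (auto simp: cycle_surface_def moment_angle_def cube_skeleton_def)
  have "y i = 1" if "i \<ge> n" for i
  proof -
    have "i \<notin> free_coords x" using x(1)[OF that] by (simp add: free_coords_def)
    then show ?thesis using y x(1)[OF that] by (simp add: open_square_def)
  qed
  then show "y \<in> cycle_surface n - cube_skeleton n"
    using y x(2,3) by (simp add: open_square_def cycle_surface_def moment_angle_def cube_skeleton_def)
qed

lemma open_square_eq: "y \<in> open_square x \<Longrightarrow> open_square y = open_square x"
  by (auto simp: open_square_def)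

text \<open>\<open>W\<close> keeps the free coordinates of \<open>x\<close> free and preserves the
  signs of the others. Off the skeleton a point has exactly two free coordinates, so no further
  coordinate can become free.\<close>

lemma openin_open_square:
  assumes "x \<in> cycle_surface n - cube_skeleton n"
  shows "openin (top_of_set (cycle_surface n - cube_skeleton n)) (open_square x)"
proof -
  define W where "W = (\<Inter>i<n. if i \<in> free_coords x then {y. \<bar>y i\<bar> < 1} else {y. 0 < y i * x i})"
  have "open {y :: nat \<Rightarrow> real. \<bar>y i\<bar> < 1}" "open {y :: nat \<Rightarrow> real. 0 < y i * x i}" for i
    by (intro open_Collect_less continuous_intros continuous_on_coordinate)+
  then have "open W"
    unfolding W_def by (intro open_INT) auto
  moreover have "open_square x = (cycle_surface n - cube_skeleton n) \<inter> W"
  proof (intro equalityI subsetI)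
    fix y assume y: "y \<in> open_square x"
    have "y \<in> (if i \<in> free_coords x then {y. \<bar>y i\<bar> < 1} else {y. 0 < y i * x i})" for i
    proof (cases "i \<in> free_coords x")
      case True
      then have "i \<in> free_coords y" "\<bar>y i\<bar> \<le> 1" using y by (auto simp: open_square_def)
      then have "\<bar>y i\<bar> < 1" by (simp add: free_coords_def)
      then show ?thesis using True by simp
    next
      case False
      then have "y i = x i" "\<bar>x i\<bar> = 1" using y by (auto simp: open_square_def free_coords_def)
      then have "0 < y i * x i" by (cases "x i \<ge> 0") auto
      then show ?thesis using False by simp
    qed
    then have "y \<in> W" unfolding W_def by (rule INT_I)
    then show "y \<in> (cycle_surface n - cube_skeleton n) \<inter> W"
      using open_square_subset[OF assms] y by blast
  next
    fix y assume y: "y \<in> (cycle_surface n - cube_skeleton n) \<inter> W"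
    have W: "if i \<in> free_coords x then \<bar>y i\<bar> < 1 else 0 < y i * x i" if "i < n" for i
    proof -
      have "y \<in> (if i \<in> free_coords x then {y. \<bar>y i\<bar> < 1} else {y. 0 < y i * x i})"
        using y that unfolding W_def by blast
      then show ?thesis by (simp split: if_splits)
    qed
    have x: "\<And>i. i \<ge> n \<Longrightarrow> x i = 1" and yn: "\<And>i. i \<ge> n \<Longrightarrow> y i = 1" "\<And>i. \<bar>y i\<bar> \<le> 1"
      using assms y by (auto simp: cycle_surface_def moment_angle_def)
    obtain k where k: "k < n" "free_coords x = {k, Suc k mod n}"
      using complement_skeleton_free[OF assms] .
    obtain l where l: "l < n" "free_coords y = {l, Suc l mod n}"
      using complement_skeleton_free[of y] y by blast
    have "free_coords x \<subseteq> free_coords y"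
    proof
      fix i assume i: "i \<in> free_coords x"
      then have "i < n" using k Suc_mod_less[OF k(1)] by auto
      then show "i \<in> free_coords y" using W[of i] i by (auto simp: free_coords_def)
    qed
    moreover have "Suc k mod n \<noteq> k" using Suc_mod_neq[OF k(1)] n_ge_3 by simp
    \<comment> \<open>Both sets have two elements, so the inclusion is an equality.\<close>
    ultimately have free: "free_coords y = free_coords x" using k(2) l(2) by auto
    have "y i = x i" if i: "i \<notin> free_coords x" for i
    proof (cases "i < n")
      case True
      have "\<bar>x i\<bar> = 1" "\<bar>y i\<bar> = 1" "0 < y i * x i"
        using i free W[OF True] by (auto simp: free_coords_def)
      then show ?thesis by (auto simp: abs_if split: if_splits)
    next
      case False
      then show ?thesis using x yn by simp
    qed
    then show "y \<in> open_square x" using free yn(2) by (simp add: open_square_def)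
  qed
  ultimately show ?thesis by (auto simp: openin_open)
qed

text \<open>The two free coordinates map the square onto an open box in the plane. The box is
  convex, hence simply connected, hence homeomorphic to the disc.\<close>

lemma open_square_homeomorphic_disc:
  assumes "x \<in> cycle_surface n - cube_skeleton n"
  shows "top_of_set (open_square x) homeomorphic_space top_of_set (ball (0 :: complex) 1)"
proof -
  obtain k where k: "k < n" "free_coords x = {k, Suc k mod n}"
    using complement_skeleton_free[OF assms] .
  let ?l = "Suc k mod n"
  have neq: "?l \<noteq> k" using Suc_mod_neq[OF k(1)] n_ge_3 by simp
  let ?B = "box (Complex (-1) (-1)) (Complex 1 1)"
  have B: "z \<in> ?B \<longleftrightarrow> \<bar>Re z\<bar> < 1 \<and> \<bar>Im z\<bar> < 1" for z
    by (auto simp: in_box_complex_iff abs_less_iff)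
  have "homeomorphic_maps (top_of_set (open_square x)) (top_of_set ?B)
      (\<lambda>y. Complex (y k) (y ?l)) (\<lambda>z. x(k := Re z, ?l := Im z))"
    unfolding homeomorphic_maps_def
  proof (intro conjI)
    have "Complex (y k) (y ?l) \<in> ?B" if "y \<in> open_square x" for y
    proof -
      have "\<bar>y k\<bar> \<noteq> 1" "\<bar>y ?l\<bar> \<noteq> 1" "\<bar>y k\<bar> \<le> 1" "\<bar>y ?l\<bar> \<le> 1"
        using that k(2) by (auto simp: open_square_def free_coords_def)
      then show ?thesis by (simp add: B)
    qed
    moreover have "continuous_on (open_square x) (\<lambda>y. Complex (y k) (y ?l))"
      unfolding Complex_eq by (intro continuous_intros continuous_on_coordinate)
    ultimately show "continuous_map (top_of_set (open_square x)) (top_of_set ?B) (\<lambda>y. Complex (y k) (y ?l))"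
      by auto
    have "x(k := Re z, ?l := Im z) \<in> open_square x" if "z \<in> ?B" for z
    proof -
      have z: "\<bar>Re z\<bar> < 1" "\<bar>Im z\<bar> < 1" using that by (auto simp: B)
      have "\<bar>x i\<bar> \<le> 1" for i using assms by (simp add: cycle_surface_def moment_angle_def)
      then show ?thesis using z k(2) by (auto simp: open_square_def free_coords_def)
    qed
    moreover have "continuous_on ?B (\<lambda>z. x(k := Re z, ?l := Im z))"
    proof (rule continuous_on_fun_upd)
      show "continuous_on ?B (\<lambda>z. (x(k := Re z)) i)" for i
        by (cases "i = k") (auto intro: continuous_intros)
    qed (intro continuous_intros)
    ultimately show "continuous_map (top_of_set ?B) (top_of_set (open_square x)) (\<lambda>z. x(k := Re z, ?l := Im z))"
      by auto
    show "\<forall>y \<in> topspace (top_of_set (open_square x)). x(k := Re (Complex (y k) (y ?l)), ?l := Im (Complex (y k) (y ?l))) = y"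
      using k(2) by (auto simp: open_square_def fun_eq_iff)
    show "\<forall>z \<in> topspace (top_of_set ?B). Complex ((x(k := Re z, ?l := Im z)) k) ((x(k := Re z, ?l := Im z)) ?l) = z"
      using neq by simp
  qed
  then have "top_of_set (open_square x) homeomorphic_space top_of_set ?B"
    by (rule homeomorphic_maps_imp_homeomorphic_space)
  moreover have "top_of_set ?B homeomorphic_space top_of_set (ball (0 :: complex) 1)"
  proof -
    have "simply_connected ?B" by (rule convex_imp_simply_connected) (rule convex_box)
    moreover have "?B \<noteq> {}" using B[of 0] by auto
    ultimately have "?B homeomorphic ball (0 :: complex) 1"
      using simply_connected_eq_homeomorphic_to_disc[OF open_box] by metis
    then obtain f g where "homeomorphism ?B (ball (0 :: complex) 1) f g"
      unfolding homeomorphic_def by metis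
    then have "homeomorphic_maps (top_of_set ?B) (top_of_set (ball (0 :: complex) 1)) f g"
      by (auto simp: homeomorphic_maps_def homeomorphism_def)
    then show ?thesis by (rule homeomorphic_maps_imp_homeomorphic_space)
  qed
  ultimately show ?thesis by (rule homeomorphic_space_trans)
qed

text \<open>The open squares partition the complement into relatively open sets, so each of them is
  also closed there. Being connected as well, they are exactly its components.\<close>

lemma connected_component_open_square:
  assumes "F \<in> connected_components_of (top_of_set (cycle_surface n - cube_skeleton n))"
  obtains x where "x \<in> cycle_surface n - cube_skeleton n" "F = open_square x"
proof -
  let ?C = "cycle_surface n - cube_skeleton n"
  have F: "connectedin (top_of_set ?C) F" "F \<subseteq> ?C" "F \<noteq> {}"
    using assms connectedin_connected_components_of connected_components_of_subset nonempty_connected_components_of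
    by fastforce+
  then obtain x where x: "x \<in> F" "x \<in> ?C" by blast
  have "?C - open_square x = (\<Union>y \<in> ?C - open_square x. open_square y)"
  proof (intro equalityI subsetI)
    fix z assume "z \<in> (\<Union>y \<in> ?C - open_square x. open_square y)"
    then obtain y where y: "y \<in> ?C" "y \<notin> open_square x" "z \<in> open_square y" by blast
    then have "z \<in> ?C" using open_square_subset by blast
    moreover have "y \<in> open_square y" using open_square_self y(1) by blast
    then have "z \<notin> open_square x" using open_square_eq y by metis
    ultimately show "z \<in> ?C - open_square x" by blast
  qed (use open_square_self in blast)
  moreover have "openin (top_of_set ?C) (\<Union>y \<in> ?C - open_square x. open_square y)"
    using openin_open_square by (intro openin_Union) blast
  ultimately have "openin (top_of_set ?C) (?C - open_square x)" by simp
  then have "closedin (top_of_set ?C) (open_square x)"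
    using open_square_subset[OF x(2)] by (simp add: closedin_def)
  then have "F \<subseteq> open_square x \<or> disjnt F (open_square x)"
    using connectedin_clopen_cases[OF F(1)] openin_open_square[OF x(2)] by blast
  moreover have "x \<in> open_square x" using open_square_self x(2) by blast
  ultimately have le: "F \<subseteq> open_square x" using x(1) by (auto simp: disjnt_iff)
  have "connected_space (top_of_set (open_square x))"
    using homeomorphic_connected_space[OF open_square_homeomorphic_disc[OF x(2)]]
    by (simp add: connected_space_subtopology convex_connected)
  then have "connected (open_square x)"
    by (simp add: connectedin_def flip: connectedin_iff_connected)
  then have "connectedin (top_of_set ?C) (open_square x)"
    using open_square_subset[OF x(2)] by (simp add: connectedin_subtopology)
  moreover have "\<not> disjnt F (open_square x)"
    using x(1) \<open>x \<in> open_square x\<close> unfolding disjnt_def by blast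
  ultimately have "open_square x \<subseteq> F"
    by (rule connected_components_of_maximal[OF assms])
  then show thesis using that[OF x(2)] le by blast
qed

lemma two_cell_embedding_cube:
  "two_cell_embedding (hypercube_vertices n) (hypercube_edges n) (top_of_set (cycle_surface n)) (cube_embedding n)"
  unfolding two_cell_embedding_def
proof (intro conjI ballI)
  let ?C = "cycle_surface n - cube_skeleton n"
  fix F assume F: "F \<in> embedding_faces (hypercube_vertices n) (hypercube_edges n)
    (top_of_set (cycle_surface n)) (cube_embedding n)"
  have "subtopology (top_of_set (cycle_surface n)) ?C = top_of_set ?C"
    by (simp add: subtopology_subtopology Int_absorb1)
  then have "F \<in> connected_components_of (top_of_set ?C)"
    using F by (simp add: embedding_faces_def cube_embedding_image)
  then obtain x where x: "x \<in> ?C" "F = open_square x"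
    by (rule connected_component_open_square)
  have "F \<subseteq> cycle_surface n" using open_square_subset[OF x(1)] x(2) by blast
  then have "subtopology (top_of_set (cycle_surface n)) F = top_of_set F"
    by (simp add: subtopology_subtopology Int_absorb1)
  then show "subtopology (top_of_set (cycle_surface n)) F homeomorphic_space top_of_set (ball (0 :: complex) 1)"
    using open_square_homeomorphic_disc[OF x(1)] x(2) by simp
qed (rule graph_embedding_cube)

end

theorem theorem2p1p8:
  fixes n :: nat
  assumes "n \<ge> 3"
  shows "\<exists>(X :: surface_point topology) f.
           surface_of_genus X (1 + (int n - 4) * 2 ^ (n - 3)) \<and>
           graph_embedding (hypercube_vertices n) (hypercube_edges n) X f \<and>
           two_cell_embedding (hypercube_vertices n) (hypercube_edges n) X f"
proof -
  interpret polygon_sectors n by unfold_locales fact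
  show ?thesis
    using surface_of_genus_cycle_surface[OF assms] graph_embedding_cube two_cell_embedding_cube by blast
qed

end
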